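(* Let $(V,g)$ be a real vector space of dimension $2n$ with a positive definite metric, let $J\in\mathcal{T}(V,g)$, and let $m_1,m_{-1}$ be nonnegative integers. For $K\in\mathcal{T}(V,g)$ let $P_0,P_1,P_{-1}$ be the projection operators onto the respective summands of the splitting $V=\operatorname{Im}[J,K]\oplus\ker(J+K)\oplus\ker(J-K)$. 1) For $K\in\mathcal{T}^{(m_1,* )}$, $T_{K}\mathcal{T}^{(m_{1},* )}= \{A \in \mathfrak{o}_{\{K \}} \mid P_{1}AP_{1}=0\}$. 2) For $K\in\mathcal{T}^{( *,m_{-1})}$, $T_{K}\mathcal{T}^{( *,m_{-1})}= \{A \in \mathfrak{o}_{\{K \}} \mid P_{-1}AP_{-1}=0\}$. 3) If $n-m_{1}-m_{-1}=2k$ for some $k\in\mathbb{Z}_{\geq 0}$, then $\mathcal{T}^{(m_{1},* )}$ and $\mathcal{T}^{( *,m_{-1})}$ intersect transversally (in $\mathcal{T}(V,g)$).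
   Context: $\mathcal{T}(V,g)=\{K\in\operatorname{End}(V)\mid K^2=-1,\ g(K\cdot,K\cdot)=g(\cdot,\cdot)\}$, a complex manifold with $T_K\mathcal{T}(V,g)=\mathfrak{o}_{\{K\}}:=\{A\in\mathfrak{o}(V,g)\mid AK+KA=0\}$, where $\mathfrak{o}(V,g)$ is the space of $g$-skew endomorphisms. For the fixed $J\in\mathcal{T}(V,g)$, $\mathcal{T}^{(m_1,* )}=\{K\in\mathcal{T}(V,g)\mid \dim\operatorname{Ker}(J+K)=2m_1\}$ and $\mathcal{T}^{( *,m_{-1})}=\{K\in\mathcal{T}(V,g)\mid \dim\operatorname{Ker}(J-K)=2m_{-1}\}$ (real dimensions); these are complex submanifolds of $\mathcal{T}(V,g)$. *)

theory Defs
  imports "HOL-Analysis.Analysis"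
begin

text \<open>
  \<open>(V, g)\<close> is a Euclidean space \<open>'a\<close> with its inner product, and \<open>End(V)\<close> is the normed space
  \<open>'a \<Rightarrow>\<^sub>L 'a\<close>, in which \<open>\<T>(V, g)\<close> and the two strata are subsets.
\<close>

definition complex_structures :: "('a::euclidean_space \<Rightarrow>\<^sub>L 'a) set" where
  "complex_structures = {K :: 'a \<Rightarrow>\<^sub>L 'a. K o\<^sub>L K = - id_blinfun \<and> (\<forall>u v. K u \<bullet> K v = u \<bullet> v)}"

definition skew_endos :: "('a::euclidean_space \<Rightarrow>\<^sub>L 'a) set" where
  "skew_endos = {A :: 'a \<Rightarrow>\<^sub>L 'a. \<forall>u v. A u \<bullet> v = - (u \<bullet> A v)}"

definition skew_anticommuting ::
  "('a::euclidean_space \<Rightarrow>\<^sub>L 'a) \<Rightarrow> ('a \<Rightarrow>\<^sub>L 'a) set" where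
  "skew_anticommuting K = {A \<in> skew_endos. (A o\<^sub>L K) + (K o\<^sub>L A) = 0}"

definition blinfun_ker :: "('a::real_normed_vector \<Rightarrow>\<^sub>L 'b::real_normed_vector) \<Rightarrow> 'a set" where
  "blinfun_ker A = {v. A v = 0}"

definition stratum_plus ::
  "('a::euclidean_space \<Rightarrow>\<^sub>L 'a) \<Rightarrow> nat \<Rightarrow> ('a \<Rightarrow>\<^sub>L 'a) set" where
  "stratum_plus J m = {K \<in> complex_structures. dim (blinfun_ker (J + K)) = 2 * m}"

definition stratum_minus ::
  "('a::euclidean_space \<Rightarrow>\<^sub>L 'a) \<Rightarrow> nat \<Rightarrow> ('a \<Rightarrow>\<^sub>L 'a) set" where
  "stratum_minus J m = {K \<in> complex_structures. dim (blinfun_ker (J - K)) = 2 * m}"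

definition commutator ::
  "('a::real_normed_vector \<Rightarrow>\<^sub>L 'a) \<Rightarrow> ('a \<Rightarrow>\<^sub>L 'a) \<Rightarrow> 'a \<Rightarrow>\<^sub>L 'a" where
  "commutator J K = (J o\<^sub>L K) - (K o\<^sub>L J)"

definition splitting_components ::
  "('a::euclidean_space \<Rightarrow>\<^sub>L 'a) \<Rightarrow> ('a \<Rightarrow>\<^sub>L 'a) \<Rightarrow> 'a \<Rightarrow> 'a \<times> 'a \<times> 'a" where
  "splitting_components J K v =
    (THE (x, y, z). x \<in> range (commutator J K) \<and> y \<in> blinfun_ker (J + K) \<and>
                    z \<in> blinfun_ker (J - K) \<and> v = x + y + z)"

definition proj_zero ::
  "('a::euclidean_space \<Rightarrow>\<^sub>L 'a) \<Rightarrow> ('a \<Rightarrow>\<^sub>L 'a) \<Rightarrow> 'a \<Rightarrow> 'a" where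
  "proj_zero J K v = fst (splitting_components J K v)"

definition proj_plus ::
  "('a::euclidean_space \<Rightarrow>\<^sub>L 'a) \<Rightarrow> ('a \<Rightarrow>\<^sub>L 'a) \<Rightarrow> 'a \<Rightarrow> 'a" where
  "proj_plus J K v = fst (snd (splitting_components J K v))"

definition proj_minus ::
  "('a::euclidean_space \<Rightarrow>\<^sub>L 'a) \<Rightarrow> ('a \<Rightarrow>\<^sub>L 'a) \<Rightarrow> 'a \<Rightarrow> 'a" where
  "proj_minus J K v = snd (snd (splitting_components J K v))"

lemma splitting_unique_existence:
  fixes J K :: "'a::euclidean_space \<Rightarrow>\<^sub>L 'a"
  assumes J: "J \<in> complex_structures" and K: "K \<in> complex_structures"
  shows "\<exists>!(x, y, z). x \<in> range (commutator J K) \<and> y \<in> blinfun_ker (J + K) \<and>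
                      z \<in> blinfun_ker (J - K) \<and> v = x + y + z"
proof -
  define C where "C = commutator J K"
  have JJ: "J (J u) = - u" and KK: "K (K u) = - u" for u
  proof -
    have "(J o\<^sub>L J) u = (- id_blinfun) u" "(K o\<^sub>L K) u = (- id_blinfun) u"
      using J K by (simp_all add: complex_structures_def)
    then show "J (J u) = - u" "K (K u) = - u"
      by (simp_all add: blinfun.bilinear_simps)
  qed
  have Jsk: "J u \<bullet> w = - (u \<bullet> J w)" and Ksk: "K u \<bullet> w = - (u \<bullet> K w)" for u w
  proof -
    have "J u \<bullet> J (J w) = u \<bullet> J w" "K u \<bullet> K (K w) = u \<bullet> K w"
      using J K by (simp_all add: complex_structures_def)
    then show "J u \<bullet> w = - (u \<bullet> J w)" "K u \<bullet> w = - (u \<bullet> K w)"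
      by (simp_all add: JJ KK)
  qed
  have C: "C u = J (K u) - K (J u)" for u
    by (simp add: C_def commutator_def blinfun.bilinear_simps)
  have Csk: "C u \<bullet> w = - (u \<bullet> C w)" for u w
    by (simp add: C inner_diff_left inner_diff_right Jsk Ksk)
  have ker_sum: "C y = 0" if "J y + K y = 0" for y
  proof -
    have "K y = - J y" "J y = - K y" using that by (simp_all add: eq_neg_iff_add_eq_0 add.commute)
    then show ?thesis by (metis C JJ KK blinfun.minus_right cancel_comm_monoid_add_class.diff_cancel)
  qed
  have ker_diff: "C y = 0" if "J y - K y = 0" for y
    using that by (simp add: C) (metis JJ KK)
  have disj: "u = 0" if hu: "u \<in> range C" "C u = 0" for u
  proof -
    obtain x where x: "u = C x" using hu(1) by blast
    have "u \<bullet> u = - (x \<bullet> C u)" using Csk[of x u] x by simp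
    then show ?thesis using hu by simp
  qed
  have lin: "linear C" by (rule linearI) (simp_all add: blinfun.bilinear_simps)
  have ker_disj: "y = 0" if "J y + K y = 0" "J y - K y = 0" for y
  proof -
    have "2 *\<^sub>R J y = 0" using that by (simp add: scaleR_2)
    then have "J y = 0" by simp
    then show ?thesis using JJ[of y] by simp
  qed
  obtain x w where x: "x \<in> span (range C)" and w: "\<And>u. u \<in> span (range C) \<Longrightarrow> orthogonal w u"
    and v: "v = x + w"
    using orthogonal_subspace_decomp_exists[of "range C" v] by metis
  have sub: "subspace (range C)" using lin by (simp add: linear_subspace_image)
  have x: "x \<in> range C" using x sub by (metis span_eq_iff)
  have "C w \<bullet> C w = 0"
    using w[of "C (C w)"] Csk[of w "C w"] by (auto simp: orthogonal_def intro: span_base)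
  then have Cw: "J (K w) = K (J w)" by (simp add: C)
  define y where "y = (1/2) *\<^sub>R (w + J (K w))"
  define z where "z = (1/2) *\<^sub>R (w - J (K w))"
  have y: "y \<in> blinfun_ker (J + K)"
    unfolding blinfun_ker_def y_def
    by (simp add: blinfun.bilinear_simps JJ) (simp add: Cw KK algebra_simps)
  have z: "z \<in> blinfun_ker (J - K)"
    unfolding blinfun_ker_def z_def
    by (simp add: blinfun.bilinear_simps JJ) (simp add: Cw KK algebra_simps)
  have yz: "w = y + z"
    by (simp add: y_def z_def algebra_simps flip: scaleR_2 scaleR_add_left)
  have uniq: "x1 = x2 \<and> y1 = y2 \<and> z1 = z2"
    if "x1 \<in> range C" "x2 \<in> range C" "y1 \<in> blinfun_ker (J + K)" "y2 \<in> blinfun_ker (J + K)"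
      "z1 \<in> blinfun_ker (J - K)" "z2 \<in> blinfun_ker (J - K)" "x1 + y1 + z1 = x2 + y2 + z2"
    for x1 x2 y1 y2 z1 z2
  proof -
    have k: "J y1 + K y1 = 0" "J y2 + K y2 = 0" "J z1 - K z1 = 0" "J z2 - K z2 = 0"
      using that by (simp_all add: blinfun_ker_def blinfun.bilinear_simps)
    have e: "x1 - x2 = (y2 - y1) + (z2 - z1)" using that(7) by (simp add: algebra_simps)
    have "C (x1 - x2) = 0"
      unfolding e by (simp add: blinfun.bilinear_simps ker_sum ker_diff k)
    moreover have "x1 - x2 \<in> range C" using that(1,2) sub subspace_diff by blast
    ultimately have "x1 - x2 = 0" by (rule disj[rotated])
    then have xx: "x1 = x2" by (rule eq_iff_diff_eq_0[THEN iffD2])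
    have e2: "y2 - y1 = z1 - z2" using e unfolding xx by (metis add_diff_cancel_left' add_diff_cancel_right' add_eq_0_iff diff_self minus_diff_eq)
    have "J (y2 - y1) + K (y2 - y1) = (J y2 + K y2) - (J y1 + K y1)"
      by (simp add: blinfun.bilinear_simps)
    then have "J (y2 - y1) + K (y2 - y1) = 0" by (simp add: k)
    moreover have "J (z1 - z2) - K (z1 - z2) = (J z1 - K z1) - (J z2 - K z2)"
      by (simp add: blinfun.bilinear_simps)
    then have "J (y2 - y1) - K (y2 - y1) = 0" by (simp add: k e2)
    ultimately have "y2 - y1 = 0" using ker_disj by blast
    then show ?thesis using xx e2 by simp
  qed
  show ?thesis
    unfolding C_def[symmetric]
  proof (rule ex1I[of _ "(x, y, z)"])
    show "case (x, y, z) of (x, y, z) \<Rightarrow> x \<in> range C \<and> y \<in> blinfun_ker (J + K) \<and>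
            z \<in> blinfun_ker (J - K) \<and> v = x + y + z"
      using x y z v yz by (simp add: add.assoc)
  next
    fix t assume t: "case t of (x, y, z) \<Rightarrow> x \<in> range C \<and> y \<in> blinfun_ker (J + K) \<and>
            z \<in> blinfun_ker (J - K) \<and> v = x + y + z"
    obtain x' y' z' where t': "t = (x', y', z')" by (rule prod_cases3)
    have h: "x' \<in> range C" "y' \<in> blinfun_ker (J + K)" "z' \<in> blinfun_ker (J - K)" "v = x' + y' + z'"
      using t unfolding t' by blast+
    have "x' + y' + z' = x + y + z" using h(4) v yz by (metis add.assoc)
    then show "t = (x, y, z)"
      using uniq[OF h(1) x h(2) y h(3) z] unfolding t' by blast
  qed
qed

text \<open>\<open>C\<^sup>\<infinity>\<close> curves: \<open>D k\<close> is the \<open>k\<close>-th derivative. The domain \<open>I\<close> is meant to be open.\<close>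

definition smooth_curve_on :: "real set \<Rightarrow> (real \<Rightarrow> 'e::real_normed_vector) \<Rightarrow> bool" where
  "smooth_curve_on I \<gamma> \<longleftrightarrow>
    (\<exists>D :: nat \<Rightarrow> real \<Rightarrow> 'e. D 0 = \<gamma> \<and>
      (\<forall>k. \<forall>t\<in>I. (D k has_vector_derivative D (Suc k) t) (at t)))"

text \<open>
  For an embedded submanifold \<open>S\<close> of a finite-dimensional normed space, the tangent space at \<open>p\<close>,
  viewed as a subspace of the ambient space, is the set of initial velocities of the smooth curves
  in \<open>S\<close> starting at \<open>p\<close>. For other sets \<open>S\<close> it need not be a subspace.
\<close>

definition tangent_space :: "'e::real_normed_vector set \<Rightarrow> 'e \<Rightarrow> 'e set" where
  "tangent_space S p =
    {v. \<exists>\<epsilon>>0. \<exists>\<gamma>. smooth_curve_on {-\<epsilon><..<\<epsilon>} \<gamma> \<and> (\<forall>t\<in>{-\<epsilon><..<\<epsilon>}. \<gamma> t \<in> S) \<and>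
        \<gamma> 0 = p \<and> (\<gamma> has_vector_derivative v) (at 0)}"

definition transversal_in ::
  "'e::real_normed_vector set \<Rightarrow> 'e set \<Rightarrow> 'e set \<Rightarrow> bool" where
  "transversal_in M S1 S2 \<longleftrightarrow>
    (\<forall>p \<in> S1 \<inter> S2. {u + v | u v. u \<in> tangent_space S1 p \<and> v \<in> tangent_space S2 p}
                    = tangent_space M p)"

end

theory Submission
  imports Defs
begin

text \<open>
  The three projections of the splitting are orthogonal, so the condition \<open>P\<^sub>1 A P\<^sub>1 = 0\<close> says that
  \<open>\<langle>A u, w\<rangle> = 0\<close> for all \<open>u, w\<close> in \<open>W = ker (J + K)\<close>. Replacing \<open>J\<close> by \<open>-J\<close> exchanges the two
  families of strata, so only \<open>ker (J + K)\<close> has to be studied.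

  Velocities of curves in the stratum satisfy this condition. Let \<open>\<gamma>\<close> be such a curve
  through \<open>K\<close>. Since
  \<open>ker (J + \<gamma> t)\<close> has constant dimension, the orthogonal projection to \<open>W\<close> maps it onto \<open>W\<close> for
  small \<open>t\<close>, so every \<open>u\<close> in \<open>W\<close> is the projection of some \<open>u'\<close> in \<open>ker (J + \<gamma> t)\<close>, and \<open>u' - u\<close> is
  \<open>O(\<parallel>\<gamma> t - K\<parallel>)\<close>. By skewness \<open>\<langle>u', (J + \<gamma> t) w\<rangle> = 0\<close>, hence \<open>\<langle>u, (\<gamma> t - K) w\<rangle>\<close> is quadratically small
  (\<open>constant_rank_defect\<close>), and its derivative \<open>\<langle>u, A w\<rangle>\<close> vanishes.

  Conversely, every such direction is a velocity. Conjugating \<open>K\<close> by a curve of orthogonal maps with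
  velocity \<open>X\<close> at the identity gives a curve of complex structures with velocity \<open>[X, K]\<close>. With \<open>P\<close>
  the orthogonal projection to \<open>W\<close>, an admissible \<open>A\<close> is the sum of its block \<open>E\<close> on the orthogonal
  complement of \<open>W\<close> and an off-diagonal part. The block \<open>E\<close> equals \<open>[Y, K]\<close> for \<open>Y = - E K / 2\<close>, which
  kills \<open>W\<close>; conjugation by its curve keeps \<open>W\<close> in the kernel, and the kernel cannot grow for small
  \<open>t\<close>. The off-diagonal part equals \<open>[X, K]\<close> for \<open>X = P A G - G A P\<close>, where \<open>G\<close> is the pseudo-inverse
  of \<open>J + K\<close>. This \<open>X\<close> commutes with \<open>J\<close>, so conjugation by its curve moves the kernel
  isomorphically. Performing one conjugation after the other gives a curve in the stratum with
  velocity \<open>A\<close> (\<open>tangent_space_stratum_plus_superset\<close>).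

  The orthogonal curves are Cayley transforms rather than exponentials: they are rational in \<open>t\<close>,
  and their smoothness follows from the formula for the derivative of a resolvent.

  Transversality is then a matter of linear algebra. In \<open>A = (A - P A P) + P A P\<close> the first summand is
  tangent to the stratum of
  \<open>J + K\<close>. The second is tangent to that of \<open>J - K\<close>, because \<open>ker (J - K)\<close> is orthogonal to \<open>W\<close>.
\<close>

section \<open>Complex structures and skew endomorphisms\<close>

lemma complex_structure_square:
  assumes "K \<in> complex_structures"
  shows "K (K v) = - v"
proof -
  have "(K o\<^sub>L K) v = (- id_blinfun) v"
    using assms by (simp add: complex_structures_def)
  then show ?thesis by (simp add: blinfun.bilinear_simps)
qed

lemma complex_structure_skew:
  assumes "K \<in> complex_structures"
  shows "K u \<bullet> v = - (u \<bullet> K v)"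
proof -
  have "K u \<bullet> K (K v) = u \<bullet> K v"
    using assms by (simp add: complex_structures_def)
  then show ?thesis by (simp add: complex_structure_square[OF assms])
qed

lemma complex_structuresI:
  fixes K :: "'a::euclidean_space \<Rightarrow>\<^sub>L 'a"
  assumes "\<And>v. K (K v) = - v" and "\<And>u v. K u \<bullet> K v = u \<bullet> v"
  shows "K \<in> complex_structures"
  unfolding complex_structures_def
  using assms by (auto intro!: blinfun_eqI simp: blinfun.bilinear_simps)

lemma skew_endosD: "A \<in> skew_endos \<Longrightarrow> A u \<bullet> v = - (u \<bullet> A v)"
  by (simp add: skew_endos_def)

lemma blinfun_eq_iff: "A = B \<longleftrightarrow> (\<forall>v. blinfun_apply A v = blinfun_apply B v)"
  by (auto intro: blinfun_eqI)

lemma blinfun_compose_id [simp]: "id_blinfun o\<^sub>L A = A" "A o\<^sub>L id_blinfun = A"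
  by (simp_all add: blinfun_eq_iff)

lemma skew_anticommuting_iff:
  "A \<in> skew_anticommuting K \<longleftrightarrow> A \<in> skew_endos \<and> (\<forall>v. A (K v) = - K (A v))"
  unfolding skew_anticommuting_def
  by (auto simp: blinfun_eq_iff blinfun.bilinear_simps eq_neg_iff_add_eq_0)

lemma subspace_blinfun_ker: "subspace (blinfun_ker N)"
  by (auto simp: subspace_def blinfun_ker_def blinfun.bilinear_simps)

section \<open>Smoothness of resolvents of skew endomorphisms\<close>

text \<open>
  Iterating the choice of a derivative inside \<open>F\<close> produces all higher derivatives, so smoothness of
  a whole family needs only its first derivatives.
\<close>

lemma smooth_curve_on_derivative_closed:
  assumes closed: "\<And>f. f \<in> F \<Longrightarrow> \<exists>g\<in>F. \<forall>t\<in>I. (f has_vector_derivative g t) (at t)"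
    and "\<gamma> \<in> F"
  shows "smooth_curve_on I \<gamma>"
proof -
  obtain d where d: "\<And>f. f \<in> F \<Longrightarrow> d f \<in> F \<and> (\<forall>t\<in>I. (f has_vector_derivative d f t) (at t))"
    using closed by metis
  have F: "(d ^^ k) \<gamma> \<in> F" for k
    by (induction k) (use d \<open>\<gamma> \<in> F\<close> in auto)
  show ?thesis
    unfolding smooth_curve_on_def
    by (rule exI[of _ "\<lambda>k. (d ^^ k) \<gamma>"]) (use d F in auto)
qed

lemma injective_blinfun_inverse:
  fixes L :: "'a::euclidean_space \<Rightarrow>\<^sub>L 'a"
  assumes "\<And>v. L v = 0 \<Longrightarrow> v = 0"
  obtains M :: "'a \<Rightarrow>\<^sub>L 'a" where "\<And>v. L (M v) = v" "\<And>v. M (L v) = v"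
proof -
  have lin: "linear L" by (simp add: blinfun.bounded_linear_right bounded_linear.linear)
  then have "inj L" using assms linear_injective_0 by blast
  then obtain f' where f': "linear f'" "\<forall>v. f' (L v) = v" "\<forall>v. L (f' v) = v"
    using linear_injective_isomorphism[OF lin] by blast
  have "blinfun_apply (Blinfun f') = f'"
    using f'(1) by (simp add: bounded_linear_Blinfun_apply linear_conv_bounded_linear)
  then show thesis using that[of "Blinfun f'"] f' by simp
qed

text \<open>
  This is the inverse of \<open>1 - (t/2) X\<close>, which exists for every \<open>t\<close> when \<open>X\<close> is skew. The factor
  \<open>1/2\<close> gives the Cayley transform of \<open>X\<close> the velocity \<open>X\<close> at \<open>0\<close>.
\<close>

definition resolvent ::
  "('a::euclidean_space \<Rightarrow>\<^sub>L 'a) \<Rightarrow> real \<Rightarrow> 'a \<Rightarrow>\<^sub>L 'a" where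
  "resolvent X t = (SOME R :: 'a \<Rightarrow>\<^sub>L 'a.
    (\<forall>v. R (v - (t/2) *\<^sub>R X v) = v) \<and> (\<forall>v. R v - (t/2) *\<^sub>R X (R v) = v))"

lemma skew_endo_self_orthogonal:
  assumes "X \<in> skew_endos"
  shows "v \<bullet> X v = 0"
  using skew_endosD[OF assms, of v v] by (simp add: inner_commute)

text \<open>\<open>v\<close> and \<open>X v\<close> are orthogonal, so Pythagoras applies.\<close>

lemma skew_perturbation_expands:
  fixes X :: "'a::euclidean_space \<Rightarrow>\<^sub>L 'a"
  assumes "X \<in> skew_endos"
  shows "norm v \<le> norm (v - s *\<^sub>R X v)"
proof -
  have "(norm (v - s *\<^sub>R X v))\<^sup>2 = (norm v)\<^sup>2 + s\<^sup>2 * (norm (X v))\<^sup>2"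
    by (simp add: power2_norm_eq_inner inner_diff_left inner_diff_right
        skew_endo_self_orthogonal[OF assms] inner_commute[of "X v" v])
       (simp add: power2_eq_square)
  then have "(norm v)\<^sup>2 \<le> (norm (v - s *\<^sub>R X v))\<^sup>2" by simp
  then show ?thesis by (rule power2_le_imp_le) simp
qed

lemma resolvent_inverse:
  assumes "X \<in> skew_endos"
  shows "resolvent X t (v - (t/2) *\<^sub>R X v) = v"
    and "resolvent X t v - (t/2) *\<^sub>R X (resolvent X t v) = v"
proof -
  define L where "L = id_blinfun - (t/2) *\<^sub>R X"
  have L: "L v = v - (t/2) *\<^sub>R X v" for v
    by (simp add: L_def blinfun.bilinear_simps)
  have "v = 0" if "L v = 0" for v
    using skew_perturbation_expands[OF assms, of v "t/2"] that by (simp add: L)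
  then obtain M :: "'a \<Rightarrow>\<^sub>L 'a" where "\<And>v. L (M v) = v" "\<And>v. M (L v) = v"
    using injective_blinfun_inverse[of L] by blast
  then have "\<exists>R :: 'a \<Rightarrow>\<^sub>L 'a. (\<forall>v. R (v - (t/2) *\<^sub>R X v) = v) \<and> (\<forall>v. R v - (t/2) *\<^sub>R X (R v) = v)"
    unfolding L by blast
  from someI_ex[OF this, folded resolvent_def]
  show "resolvent X t (v - (t/2) *\<^sub>R X v) = v"
    and "resolvent X t v - (t/2) *\<^sub>R X (resolvent X t v) = v" by auto
qed

lemma norm_resolvent_le:
  assumes "X \<in> skew_endos"
  shows "norm (resolvent X t) \<le> 1"
proof (rule norm_blinfun_bound)
  fix v
  show "norm (resolvent X t v) \<le> 1 * norm v"
    using skew_perturbation_expands[OF assms, of "resolvent X t v" "t/2"]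
    by (simp add: resolvent_inverse[OF assms])
qed simp

lemma resolvent_identity:
  fixes X :: "'a::euclidean_space \<Rightarrow>\<^sub>L 'a"
  assumes "X \<in> skew_endos"
  shows "resolvent X s - resolvent X t =
    (s - t) *\<^sub>R (resolvent X s o\<^sub>L (((1/2) *\<^sub>R X) o\<^sub>L resolvent X t))"
proof (rule blinfun_eqI)
  fix v
  define w where "w = resolvent X t v"
  have w: "v = w - (t/2) *\<^sub>R X w"
    unfolding w_def by (simp add: resolvent_inverse[OF assms])
  have "w = resolvent X s (w - (s/2) *\<^sub>R X w)"
    by (simp add: resolvent_inverse[OF assms])
  then have "resolvent X s v - w = resolvent X s (v - (w - (s/2) *\<^sub>R X w))"
    by (simp add: blinfun.bilinear_simps)
  also have "v - (w - (s/2) *\<^sub>R X w) = ((s - t)/2) *\<^sub>R X w"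
    by (simp add: w algebra_simps diff_divide_distrib)
  finally show "(resolvent X s - resolvent X t) v =
      ((s - t) *\<^sub>R (resolvent X s o\<^sub>L (((1/2) *\<^sub>R X) o\<^sub>L resolvent X t))) v"
    by (simp add: blinfun.bilinear_simps w_def)
qed

text \<open>
  The resolvent identity gives first Lipschitz continuity, as resolvents of skew maps have norm at
  most \<open>1\<close>, and then the limit of the difference quotient.
\<close>

lemma has_vector_derivative_resolvent:
  fixes X :: "'a::euclidean_space \<Rightarrow>\<^sub>L 'a"
  assumes X: "X \<in> skew_endos"
  shows "(resolvent X has_vector_derivative
    (resolvent X t o\<^sub>L (((1/2) *\<^sub>R X) o\<^sub>L resolvent X t))) (at t)"
proof -
  let ?R = "resolvent X"
  have le: "norm (?R s - ?R t) \<le> norm X / 2 * \<bar>s - t\<bar>" for s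
  proof -
    have "norm (?R s o\<^sub>L (((1/2) *\<^sub>R X) o\<^sub>L ?R t)) \<le>
        norm (?R s) * (norm ((1/2) *\<^sub>R X) * norm (?R t))"
      by (meson norm_blinfun_compose mult_left_mono norm_ge_zero order_trans)
    also have "\<dots> \<le> 1 * (norm ((1/2) *\<^sub>R X) * 1)"
      by (intro mult_mono norm_resolvent_le X mult_nonneg_nonneg) auto
    finally have "\<bar>s - t\<bar> * norm (?R s o\<^sub>L (((1/2) *\<^sub>R X) o\<^sub>L ?R t)) \<le> \<bar>s - t\<bar> * (norm X / 2)"
      by (intro mult_left_mono) auto
    then show ?thesis
      unfolding resolvent_identity[OF X, of s t] norm_scaleR by (simp add: mult.commute)
  qed
  have "((\<lambda>s. norm X / 2 * \<bar>s - t\<bar>) \<longlongrightarrow> norm X / 2 * \<bar>t - t\<bar>) (at t)"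
    by (intro tendsto_intros)
  then have "((\<lambda>s. norm X / 2 * \<bar>s - t\<bar>) \<longlongrightarrow> 0) (at t)" by simp
  then have "((\<lambda>s. ?R s - ?R t) \<longlongrightarrow> 0) (at t)"
    by (rule Lim_null_comparison[rotated]) (intro always_eventually allI le)
  then have cont: "(?R \<longlongrightarrow> ?R t) (at t)" by (simp add: LIM_zero_iff)
  let ?Y = "((1/2) *\<^sub>R X) o\<^sub>L ?R t"
  have "((\<lambda>s. norm ((?R s - ?R t) o\<^sub>L ?Y)) \<longlongrightarrow> norm ((?R t - ?R t) o\<^sub>L ?Y)) (at t)"
    by (intro tendsto_norm bounded_bilinear.tendsto[OF bounded_bilinear_blinfun_compose]
        tendsto_diff cont tendsto_const)
  then have lim: "((\<lambda>s. norm ((?R s - ?R t) o\<^sub>L ?Y)) \<longlongrightarrow> 0) (at t)"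
    by (simp add: bounded_bilinear.zero_left[OF bounded_bilinear_blinfun_compose])
  have quot: "norm ((?R s - ?R t) o\<^sub>L ?Y) =
      norm (?R s - ?R t - (s - t) *\<^sub>R (?R t o\<^sub>L ?Y)) / norm (s - t)" if "s \<noteq> t" for s
  proof -
    have "?R s - ?R t - (s - t) *\<^sub>R (?R t o\<^sub>L ?Y) =
        (s - t) *\<^sub>R (?R s o\<^sub>L ?Y) - (s - t) *\<^sub>R (?R t o\<^sub>L ?Y)"
      by (simp only: resolvent_identity[OF X, of s t])
    also have "\<dots> = (s - t) *\<^sub>R ((?R s - ?R t) o\<^sub>L ?Y)"
      by (simp only: bounded_bilinear.diff_left[OF bounded_bilinear_blinfun_compose] scaleR_diff_right)
    finally show ?thesis using that by simp
  qed
  have "((\<lambda>s. norm (?R s - ?R t - (s - t) *\<^sub>R (?R t o\<^sub>L ?Y)) / norm (s - t)) \<longlongrightarrow> 0) (at t)"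
    by (rule Lim_transform_eventually[OF lim])
       (use quot in \<open>auto simp: eventually_at intro!: exI[of _ 1]\<close>)
  then show ?thesis
    unfolding has_vector_derivative_def has_derivative_iff_norm
    by (auto intro: bounded_linear_scaleR_left)
qed


text \<open>
  The derivative of a resolvent is again a product of resolvents and constants, so the algebra
  generated by them is closed under differentiation. All curves constructed below lie in it.
\<close>

inductive_set resolvent_algebra :: "(real \<Rightarrow> 'a::euclidean_space \<Rightarrow>\<^sub>L 'a) set" where
  resolvent: "X \<in> skew_endos \<Longrightarrow> resolvent X \<in> resolvent_algebra"
| const: "(\<lambda>_. L) \<in> resolvent_algebra"
| add: "f \<in> resolvent_algebra \<Longrightarrow> g \<in> resolvent_algebra \<Longrightarrow>
    (\<lambda>t. f t + g t) \<in> resolvent_algebra"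
| compose: "f \<in> resolvent_algebra \<Longrightarrow> g \<in> resolvent_algebra \<Longrightarrow>
    (\<lambda>t. f t o\<^sub>L g t) \<in> resolvent_algebra"

lemma resolvent_algebra_derivative:
  assumes "f \<in> resolvent_algebra"
  shows "\<exists>g\<in>resolvent_algebra. \<forall>t. (f has_vector_derivative g t) (at t)"
  using assms
proof induction
  case (resolvent X)
  then show ?case
    by (intro bexI[of _ "\<lambda>t. resolvent X t o\<^sub>L (((1/2) *\<^sub>R X) o\<^sub>L resolvent X t)"] allI
        has_vector_derivative_resolvent resolvent_algebra.intros)
next
  case (const L)
  show ?case
    by (intro bexI[of _ "\<lambda>_. 0"]) (auto intro: resolvent_algebra.intros)
next
  case (add f g)
  then obtain f' g' where "f' \<in> resolvent_algebra" "g' \<in> resolvent_algebra"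
    "\<forall>t. (f has_vector_derivative f' t) (at t)" "\<forall>t. (g has_vector_derivative g' t) (at t)"
    by blast
  then show ?case
    by (intro bexI[of _ "\<lambda>t. f' t + g' t"])
       (auto intro: resolvent_algebra.intros has_vector_derivative_add)
next
  case (compose f g)
  then obtain f' g' where "f' \<in> resolvent_algebra" "g' \<in> resolvent_algebra"
    "\<forall>t. (f has_vector_derivative f' t) (at t)" "\<forall>t. (g has_vector_derivative g' t) (at t)"
    by blast
  then show ?case using compose.hyps
    by (intro bexI[of _ "\<lambda>t. (f t o\<^sub>L g' t) + (f' t o\<^sub>L g t)"])
       (auto intro: resolvent_algebra.intros
         bounded_bilinear.has_vector_derivative[OF bounded_bilinear_blinfun_compose])
qed

lemma smooth_resolvent_algebra:
  "f \<in> resolvent_algebra \<Longrightarrow> smooth_curve_on I f"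
  by (rule smooth_curve_on_derivative_closed[of resolvent_algebra])
     (use resolvent_algebra_derivative in blast)+

section \<open>Cayley transforms and conjugation\<close>

text \<open>
  The usual \<open>(1 - (t/2) X)\<^sup>-\<^sup>1 (1 + (t/2) X)\<close>, written as \<open>2 (1 - (t/2) X)\<^sup>-\<^sup>1 - 1\<close> to display it as an
  element of the resolvent algebra.
\<close>

definition cayley :: "('a::euclidean_space \<Rightarrow>\<^sub>L 'a) \<Rightarrow> real \<Rightarrow> 'a \<Rightarrow>\<^sub>L 'a" where
  "cayley X t = resolvent X t + resolvent X t + - id_blinfun"

lemma cayley_in_resolvent_algebra:
  assumes "X \<in> skew_endos"
  shows "cayley X \<in> resolvent_algebra"
proof -
  have "(\<lambda>t. resolvent X t + resolvent X t + - id_blinfun) \<in> resolvent_algebra"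
    by (intro resolvent_algebra.intros assms)
  moreover have "cayley X = (\<lambda>t. resolvent X t + resolvent X t + - id_blinfun)"
    by (simp add: cayley_def fun_eq_iff)
  ultimately show ?thesis by simp
qed

lemma resolvent_zero:
  assumes "X \<in> skew_endos"
  shows "resolvent X 0 = id_blinfun"
  using resolvent_inverse(1)[OF assms, of 0] by (simp add: blinfun_eq_iff)

lemma cayley_zero:
  assumes "X \<in> skew_endos"
  shows "cayley X 0 = id_blinfun"
  by (simp add: cayley_def resolvent_zero[OF assms])

lemma has_vector_derivative_cayley:
  assumes "X \<in> skew_endos"
  shows "(cayley X has_vector_derivative X) (at 0)"
proof -
  have "(resolvent X has_vector_derivative (1/2) *\<^sub>R X) (at 0)"
    using has_vector_derivative_resolvent[OF assms, of 0]
    by (simp add: resolvent_zero[OF assms])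
  then have "((\<lambda>t. resolvent X t + resolvent X t + - id_blinfun) has_vector_derivative
      (1/2) *\<^sub>R X + (1/2) *\<^sub>R X + 0) (at 0)"
    by (intro has_vector_derivative_add has_vector_derivative_const)
  moreover have "(1/2) *\<^sub>R X + (1/2) *\<^sub>R X + 0 = X"
    by (simp flip: scaleR_add_left)
  moreover have "cayley X = (\<lambda>t. resolvent X t + resolvent X t + - id_blinfun)"
    by (simp add: cayley_def fun_eq_iff)
  ultimately show ?thesis by simp
qed

text \<open>
  Writing vectors as \<open>w - (t/2) X w\<close> removes the inverse from the Cayley transform. The algebraic
  properties below then reduce to computations with \<open>X\<close>.
\<close>

lemma cayley_parametrize:
  assumes "X \<in> skew_endos"
  obtains w where "v = w - (t/2) *\<^sub>R X w" "cayley X t v = w + (t/2) *\<^sub>R X w"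
proof
  let ?w = "resolvent X t v"
  show v: "v = ?w - (t/2) *\<^sub>R X ?w" by (simp add: resolvent_inverse[OF assms])
  show "cayley X t v = ?w + (t/2) *\<^sub>R X ?w"
    using v by (simp add: cayley_def blinfun.bilinear_simps algebra_simps)
qed

lemma cayley_apply:
  assumes "X \<in> skew_endos"
  shows "cayley X t (w - (t/2) *\<^sub>R X w) = w + (t/2) *\<^sub>R X w"
  by (simp add: cayley_def blinfun.add_left blinfun.diff_left resolvent_inverse[OF assms])

lemma skew_endos_minus:
  "X \<in> skew_endos \<Longrightarrow> - X \<in> skew_endos"
  by (simp add: skew_endos_def blinfun.bilinear_simps)

lemma cayley_minus_cancel:
  assumes "X \<in> skew_endos"
  shows "cayley (- X) t (cayley X t v) = v"
proof -
  obtain w where w: "v = w - (t/2) *\<^sub>R X w" "cayley X t v = w + (t/2) *\<^sub>R X w"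
    using cayley_parametrize[OF assms] .
  show ?thesis
    unfolding w(2) unfolding w(1)
    using cayley_apply[OF skew_endos_minus[OF assms], of t w] by (simp add: blinfun.minus_left)
qed

lemma cayley_cancel:
  assumes "X \<in> skew_endos"
  shows "cayley X t (cayley (- X) t v) = v"
  using cayley_minus_cancel[OF skew_endos_minus[OF assms]] by simp

lemma cayley_isometry:
  assumes "X \<in> skew_endos"
  shows "cayley X t u \<bullet> cayley X t v = u \<bullet> v"
proof -
  obtain a where a: "u = a - (t/2) *\<^sub>R X a" "cayley X t u = a + (t/2) *\<^sub>R X a"
    using cayley_parametrize[OF assms] .
  obtain b where b: "v = b - (t/2) *\<^sub>R X b" "cayley X t v = b + (t/2) *\<^sub>R X b"
    using cayley_parametrize[OF assms] .
  show ?thesis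
    unfolding a(2) b(2) unfolding a(1) b(1)
    by (simp add: inner_diff_left inner_diff_right inner_add_left inner_add_right
        skew_endosD[OF assms, of a b] algebra_simps)
qed

lemma cayley_commute:
  fixes X L :: "'a::euclidean_space \<Rightarrow>\<^sub>L 'a"
  assumes X: "X \<in> skew_endos" and comm: "\<And>v. X (L v) = L (X v)"
  shows "cayley X t (L v) = L (cayley X t v)"
proof -
  obtain w where w: "v = w - (t/2) *\<^sub>R X w" "cayley X t v = w + (t/2) *\<^sub>R X w"
    using cayley_parametrize[OF X] .
  have "L v = L w - (t/2) *\<^sub>R X (L w)" "L (cayley X t v) = L w + (t/2) *\<^sub>R X (L w)"
    unfolding w(2) unfolding w(1) by (simp_all add: blinfun.bilinear_simps comm)
  then show ?thesis by (simp only: cayley_apply[OF X])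
qed

lemma cayley_fix:
  assumes X: "X \<in> skew_endos" and "X v = 0"
  shows "cayley X t v = v"
  using cayley_apply[OF X, of t v] assms(2) by simp

definition conjugation_curve ::
  "('a::euclidean_space \<Rightarrow>\<^sub>L 'a) \<Rightarrow> (real \<Rightarrow> 'a \<Rightarrow>\<^sub>L 'a) \<Rightarrow> real \<Rightarrow> 'a \<Rightarrow>\<^sub>L 'a" where
  "conjugation_curve X \<gamma> t = cayley X t o\<^sub>L (\<gamma> t o\<^sub>L cayley (- X) t)"

lemma conjugation_curve_apply:
  "conjugation_curve X \<gamma> t v = cayley X t (\<gamma> t (cayley (- X) t v))"
  by (simp add: conjugation_curve_def)

lemma conjugation_curve_in_resolvent_algebra:
  assumes "X \<in> skew_endos" "\<gamma> \<in> resolvent_algebra"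
  shows "conjugation_curve X \<gamma> \<in> resolvent_algebra"
proof -
  have "(\<lambda>t. cayley X t o\<^sub>L (\<gamma> t o\<^sub>L cayley (- X) t)) \<in> resolvent_algebra"
    by (intro resolvent_algebra.compose cayley_in_resolvent_algebra skew_endos_minus assms)
  moreover have "conjugation_curve X \<gamma> = (\<lambda>t. cayley X t o\<^sub>L (\<gamma> t o\<^sub>L cayley (- X) t))"
    by (simp add: conjugation_curve_def fun_eq_iff)
  ultimately show ?thesis by simp
qed

lemma conjugation_curve_zero:
  assumes "X \<in> skew_endos"
  shows "conjugation_curve X \<gamma> 0 = \<gamma> 0"
  by (simp add: conjugation_curve_def cayley_zero skew_endos_minus assms)

lemma conjugation_curve_complex_structure:
  assumes X: "X \<in> skew_endos" and K: "\<gamma> t \<in> complex_structures"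
  shows "conjugation_curve X \<gamma> t \<in> complex_structures"
proof (rule complex_structuresI)
  fix u v
  show "conjugation_curve X \<gamma> t (conjugation_curve X \<gamma> t v) = - v"
    by (simp add: conjugation_curve_apply cayley_minus_cancel[OF X] complex_structure_square[OF K]
        blinfun.minus_right cayley_cancel[OF X])
  have "\<gamma> t a \<bullet> \<gamma> t b = a \<bullet> b" for a b
    using K by (simp add: complex_structures_def)
  then show "conjugation_curve X \<gamma> t u \<bullet> conjugation_curve X \<gamma> t v = u \<bullet> v"
    by (simp add: conjugation_curve_apply cayley_isometry[OF X]
        cayley_isometry[OF skew_endos_minus[OF X]])
qed

lemma has_vector_derivative_conjugation_curve:
  assumes X: "X \<in> skew_endos" and \<gamma>: "(\<gamma> has_vector_derivative E) (at 0)"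
  shows "(conjugation_curve X \<gamma> has_vector_derivative commutator X (\<gamma> 0) + E) (at 0)"
proof -
  have inner: "((\<lambda>t. \<gamma> t o\<^sub>L cayley (- X) t) has_vector_derivative
      (\<gamma> 0 o\<^sub>L (- X)) + (E o\<^sub>L cayley (- X) 0)) (at 0)"
    by (intro bounded_bilinear.has_vector_derivative[OF bounded_bilinear_blinfun_compose] \<gamma>
        has_vector_derivative_cayley skew_endos_minus X)
  have "((\<lambda>t. cayley X t o\<^sub>L (\<gamma> t o\<^sub>L cayley (- X) t)) has_vector_derivative
      (cayley X 0 o\<^sub>L ((\<gamma> 0 o\<^sub>L (- X)) + (E o\<^sub>L cayley (- X) 0))) +
      (X o\<^sub>L (\<gamma> 0 o\<^sub>L cayley (- X) 0))) (at 0)"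
    by (intro bounded_bilinear.has_vector_derivative[OF bounded_bilinear_blinfun_compose]
        has_vector_derivative_cayley X inner)
  moreover have "(cayley X 0 o\<^sub>L ((\<gamma> 0 o\<^sub>L (- X)) + (E o\<^sub>L cayley (- X) 0))) +
      (X o\<^sub>L (\<gamma> 0 o\<^sub>L cayley (- X) 0)) = commutator X (\<gamma> 0) + E"
    by (simp add: cayley_zero X skew_endos_minus commutator_def blinfun_eq_iff blinfun.bilinear_simps)
  moreover have "conjugation_curve X \<gamma> = (\<lambda>t. cayley X t o\<^sub>L (\<gamma> t o\<^sub>L cayley (- X) t))"
    by (simp add: conjugation_curve_def fun_eq_iff)
  ultimately show ?thesis by simp
qed

section \<open>Tangent spaces of the space of complex structures\<close>

lemma tangent_spaceI:
  assumes "\<gamma> \<in> resolvent_algebra" "\<epsilon> > 0" "\<And>t. \<bar>t\<bar> < \<epsilon> \<Longrightarrow> \<gamma> t \<in> S"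
    "\<gamma> 0 = p" "(\<gamma> has_vector_derivative v) (at 0)"
  shows "v \<in> tangent_space S p"
  unfolding tangent_space_def mem_Collect_eq
  by (intro exI[of _ \<epsilon>] exI[of _ \<gamma>] conjI ballI smooth_resolvent_algebra assms) auto

lemma tangent_spaceE:
  assumes "v \<in> tangent_space S p"
  obtains \<epsilon> \<gamma> where "\<epsilon> > 0" "\<And>t. \<bar>t\<bar> < \<epsilon> \<Longrightarrow> \<gamma> t \<in> S" "\<gamma> 0 = p"
    "(\<gamma> has_vector_derivative v) (at 0)"
proof -
  obtain \<epsilon> \<gamma> where "\<epsilon> > 0" "\<forall>t\<in>{-\<epsilon><..<\<epsilon>}. \<gamma> t \<in> S" "\<gamma> 0 = p"
    "(\<gamma> has_vector_derivative v) (at 0)"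
    using assms unfolding tangent_space_def by blast
  then show thesis using that[of \<epsilon> \<gamma>] by (simp add: abs_less_iff)
qed

text \<open>
  The derivation \<open>[\<cdot>, K]\<close> is surjective onto the maps anticommuting with \<open>K\<close>: as \<open>K A K = A\<close>,
  one has \<open>[A K, K] = - 2 A\<close>.
\<close>

lemma commutator_half_twist:
  assumes K: "K \<in> complex_structures" and A: "A \<in> skew_anticommuting K"
  shows "(-1/2) *\<^sub>R (A o\<^sub>L K) \<in> skew_endos"
    and "commutator ((-1/2) *\<^sub>R (A o\<^sub>L K)) K = A"
proof -
  have anti: "A (K v) = - K (A v)" for v
    using A by (simp add: skew_anticommuting_iff)
  have skew: "A u \<bullet> v = - (u \<bullet> A v)" for u v
    using A by (simp add: skew_anticommuting_iff skew_endosD)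
  show "(-1/2) *\<^sub>R (A o\<^sub>L K) \<in> skew_endos"
    unfolding skew_endos_def
    by (simp add: blinfun.bilinear_simps skew complex_structure_skew[OF K])
       (simp add: anti)
  show "commutator ((-1/2) *\<^sub>R (A o\<^sub>L K)) K = A"
  proof (rule blinfun_eqI)
    fix v
    have "commutator ((-1/2) *\<^sub>R (A o\<^sub>L K)) K v = (1/2) *\<^sub>R A v + (1/2) *\<^sub>R A v"
      by (simp add: commutator_def blinfun.bilinear_simps complex_structure_square[OF K])
         (simp add: anti blinfun.minus_right complex_structure_square[OF K])
    then show "commutator ((-1/2) *\<^sub>R (A o\<^sub>L K)) K v = A v"
      by (simp flip: scaleR_add_left)
  qed
qed

text \<open>
  Differentiating \<open>K\<^sup>2 = -1\<close> gives the anticommutation and differentiating the skewness of \<open>K\<close> gives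
  that of \<open>A\<close>. Since \<open>S\<close> is arbitrary, the lemma also applies to the strata.
\<close>

lemma tangent_space_complex_structures_subset:
  assumes S: "S \<subseteq> complex_structures"
  shows "tangent_space S K \<subseteq> skew_anticommuting K"
proof
  fix A assume "A \<in> tangent_space S K"
  then obtain \<epsilon> \<gamma> where \<epsilon>: "\<epsilon> > 0" and \<gamma>: "\<And>t. \<bar>t\<bar> < \<epsilon> \<Longrightarrow> \<gamma> t \<in> S"
    and 0: "\<gamma> 0 = K" and deriv: "(\<gamma> has_vector_derivative A) (at 0)"
    by (rule tangent_spaceE) blast
  have cs: "\<gamma> t \<in> complex_structures" if "\<bar>t\<bar> < \<epsilon>" for t using \<gamma>[OF that] S by blast
  have const: "D = 0"
    if "(f has_vector_derivative D) (at 0)" "\<And>t. \<bar>t\<bar> < \<epsilon> \<Longrightarrow> f t = c"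
    for f :: "real \<Rightarrow> 'e::real_normed_vector" and c D
  proof -
    have "(f has_vector_derivative 0) (at 0)"
      by (rule has_vector_derivative_transform_within_open[of "\<lambda>_. c" 0 0 "{-\<epsilon><..<\<epsilon>}"])
         (use \<epsilon> that(2) in auto)
    then show ?thesis using that(1) vector_derivative_unique_at by blast
  qed
  have "((\<lambda>t. \<gamma> t o\<^sub>L \<gamma> t) has_vector_derivative (\<gamma> 0 o\<^sub>L A) + (A o\<^sub>L \<gamma> 0)) (at 0)"
    by (intro bounded_bilinear.has_vector_derivative[OF bounded_bilinear_blinfun_compose] deriv)
  then have "(\<gamma> 0 o\<^sub>L A) + (A o\<^sub>L \<gamma> 0) = 0"
    by (rule const[of _ _ "- id_blinfun"]) (use cs in \<open>simp add: complex_structures_def\<close>)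
  then have anti: "A (K v) = - K (A v)" for v
    by (simp add: 0 blinfun_eq_iff blinfun.bilinear_simps eq_neg_iff_add_eq_0 add.commute)
  have "A u \<bullet> v + u \<bullet> A v = 0" for u v
  proof (rule const[of "\<lambda>t. \<gamma> t u \<bullet> v + u \<bullet> \<gamma> t v" _ 0])
    have "((\<lambda>t. \<gamma> t x) has_vector_derivative A x) (at 0)" for x
      by (rule bounded_linear.has_vector_derivative[OF _ deriv]) (rule blinfun.bounded_linear_left)
    then show "((\<lambda>t. \<gamma> t u \<bullet> v + u \<bullet> \<gamma> t v) has_vector_derivative A u \<bullet> v + u \<bullet> A v) (at 0)"
      by (intro has_vector_derivative_add bounded_linear.has_vector_derivative[OF bounded_linear_inner_left]
          bounded_linear.has_vector_derivative[OF bounded_linear_inner_right])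
    show "\<gamma> t u \<bullet> v + u \<bullet> \<gamma> t v = 0" if "\<bar>t\<bar> < \<epsilon>" for t
      using complex_structure_skew[OF cs[OF that]] by simp
  qed
  then show "A \<in> skew_anticommuting K"
    by (simp add: skew_anticommuting_iff anti skew_endos_def eq_neg_iff_add_eq_0)
qed

lemma tangent_space_complex_structures:
  assumes K: "K \<in> complex_structures"
  shows "tangent_space complex_structures K = skew_anticommuting K"
proof
  show "skew_anticommuting K \<subseteq> tangent_space complex_structures K"
  proof
    fix A assume A: "A \<in> skew_anticommuting K"
    obtain X where X: "X \<in> skew_endos" "commutator X K = A"
      using commutator_half_twist[OF K A] by blast
    show "A \<in> tangent_space complex_structures K"
    proof (rule tangent_spaceI[of "conjugation_curve X (\<lambda>_. K)" 1])
      show "(conjugation_curve X (\<lambda>_. K) has_vector_derivative A) (at 0)"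
        using has_vector_derivative_conjugation_curve[OF X(1) has_vector_derivative_const[of K]]
        unfolding X(2) by simp
    qed (simp_all add: conjugation_curve_in_resolvent_algebra conjugation_curve_zero
        conjugation_curve_complex_structure resolvent_algebra.const X K)
  qed
qed (rule tangent_space_complex_structures_subset, simp)


section \<open>Kernels of skew maps under perturbation\<close>

lemma orthogonal_projection_blinfun:
  fixes W :: "'a::euclidean_space set"
  assumes W: "subspace W"
  obtains P :: "'a \<Rightarrow>\<^sub>L 'a" where "\<And>v. P v \<in> W" "\<And>v w. w \<in> W \<Longrightarrow> (v - P v) \<bullet> w = 0"
proof -
  have "\<exists>p\<in>W. \<forall>w\<in>W. (v - p) \<bullet> w = 0" for v
  proof -
    obtain y z where "y \<in> span W" "\<And>w. w \<in> span W \<Longrightarrow> orthogonal z w" "v = y + z"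
      using orthogonal_subspace_decomp_exists[of W v] by metis
    moreover have "span W = W" using W by (simp add: span_eq_iff)
    ultimately show ?thesis
      by (intro bexI[of _ y]) (auto simp: orthogonal_def)
  qed
  then obtain p where p: "\<And>v. p v \<in> W" "\<And>v w. w \<in> W \<Longrightarrow> (v - p v) \<bullet> w = 0"
    by metis
  have unique: "a = b" if "a \<in> W" "b \<in> W" "\<And>w. w \<in> W \<Longrightarrow> (v - a) \<bullet> w = 0"
      "\<And>w. w \<in> W \<Longrightarrow> (v - b) \<bullet> w = 0" for a b v
  proof -
    have "a - b \<in> W" using that W by (simp add: subspace_diff)
    then have "(v - b) \<bullet> (a - b) - (v - a) \<bullet> (a - b) = 0" using that by simp
    then have "(a - b) \<bullet> (a - b) = 0" by (simp add: inner_diff_left)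
    then show ?thesis by simp
  qed
  have "linear p"
  proof (rule linearI)
    fix u v :: 'a and c :: real
    show "p (u + v) = p u + p v"
    proof (rule unique[of _ _ "u + v"])
      fix w assume w: "w \<in> W"
      have "(u + v - (p u + p v)) \<bullet> w = (u - p u) \<bullet> w + (v - p v) \<bullet> w"
        by (simp add: inner_diff_left inner_add_left)
      then show "(u + v - (p u + p v)) \<bullet> w = 0" using p(2)[OF w] by simp
    qed (use p W in \<open>auto intro: subspace_add\<close>)
    show "p (c *\<^sub>R v) = c *\<^sub>R p v"
    proof (rule unique[of _ _ "c *\<^sub>R v"])
      fix w assume w: "w \<in> W"
      have "(c *\<^sub>R v - c *\<^sub>R p v) \<bullet> w = c * ((v - p v) \<bullet> w)"
        by (simp add: inner_diff_left algebra_simps)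
      then show "(c *\<^sub>R v - c *\<^sub>R p v) \<bullet> w = 0" using p(2)[OF w] by simp
    qed (use p W in \<open>auto intro: subspace_scale\<close>)
  qed
  then have "blinfun_apply (Blinfun p) = p"
    by (simp add: bounded_linear_Blinfun_apply linear_conv_bounded_linear)
  then show thesis using that[of "Blinfun p"] p by simp
qed

text \<open>
  For a skew map \<open>N\<close>, the image is the orthogonal complement of the kernel. \<open>P\<close> is the orthogonal
  projection onto the kernel, and \<open>G\<close> is the Moore-Penrose inverse.
\<close>

locale skew_pseudoinverse =
  fixes N P G :: "'a::euclidean_space \<Rightarrow>\<^sub>L 'a"
  assumes skew: "N u \<bullet> v = - (u \<bullet> N v)"
    and N_P: "N (P v) = 0"
    and P_fix: "N w = 0 \<Longrightarrow> P w = w"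
    and P_selfadjoint: "P u \<bullet> v = u \<bullet> P v"
    and G_N: "G (N v) = v - P v"
    and N_G: "N (G v) = v - P v"
    and P_G: "P (G v) = 0"
begin

lemma P_idem: "P (P v) = P v"
  by (rule P_fix[OF N_P])

lemma P_N: "P (N v) = 0"
  using N_G[of "N v"] by (simp add: G_N blinfun.diff_right N_P)

lemma G_P: "G (P v) = 0"
  using P_fix[of "G (P v)"] by (simp add: N_G P_idem P_G)

lemma G_skew: "G u \<bullet> v = - (u \<bullet> G v)"
proof -
  have "G u \<bullet> v = G u \<bullet> (v - P v)"
    by (simp add: inner_diff_right P_selfadjoint[symmetric] P_G)
  also have "\<dots> = - ((u - P u) \<bullet> G v)"
    using skew[of "G u" "G v"] by (simp add: N_G)
  also have "\<dots> = - (u \<bullet> G v)"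
    by (simp add: inner_diff_left P_selfadjoint P_G)
  finally show ?thesis .
qed

text \<open>
  A vector in the kernel of \<open>M\<close> is close to the kernel of \<open>N\<close>: on it \<open>N = N - M\<close>, and
  \<open>1 - P = G N\<close>.
\<close>

lemma pseudoinverse_near:
  fixes M :: "'a \<Rightarrow>\<^sub>L 'a"
  assumes "M v = 0"
  shows "norm (v - P v) \<le> norm G * norm (M - N) * norm v"
proof -
  have "v - P v = - G ((M - N) v)"
    by (simp add: G_N[symmetric] blinfun.bilinear_simps assms)
  then have "norm (v - P v) = norm (G ((M - N) v))" by simp
  also have "\<dots> \<le> norm G * norm ((M - N) v)" by (rule norm_blinfun)
  also have "\<dots> \<le> norm G * (norm (M - N) * norm v)"
    by (intro mult_left_mono norm_blinfun norm_ge_zero)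
  finally show ?thesis by (simp add: mult.assoc)
qed

lemma kernel_near_disjoint:
  fixes M :: "'a \<Rightarrow>\<^sub>L 'a"
  assumes "norm G * norm (M - N) < 1" "M v = 0" "P v = 0"
  shows "v = 0"
proof (rule ccontr)
  assume "v \<noteq> 0"
  then have "norm G * norm (M - N) * norm v < 1 * norm v"
    using assms(1) by (intro mult_strict_right_mono) auto
  then show False using pseudoinverse_near[OF assms(2)] assms(3) by simp
qed

text \<open>
  Kernels cannot grow under small perturbations: modulo \<open>ker N\<close>, a kernel vector of \<open>M\<close> is
  orthogonal to \<open>ker N\<close> and hence zero.
\<close>

lemma kernel_near_eq:
  fixes M :: "'a \<Rightarrow>\<^sub>L 'a"
  assumes "norm G * norm (M - N) < 1" and "\<And>w. N w = 0 \<Longrightarrow> M w = 0"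
  shows "blinfun_ker M = blinfun_ker N"
proof -
  have "N v = 0" if "M v = 0" for v
  proof -
    have "M (v - P v) = 0" by (simp add: blinfun.diff_right that assms(2) N_P)
    then have "v - P v = 0"
      by (rule kernel_near_disjoint[OF assms(1)]) (simp add: blinfun.diff_right P_idem)
    then show ?thesis using N_P[of v] by simp
  qed
  then show ?thesis using assms(2) by (auto simp: blinfun_ker_def)
qed

text \<open>
  The projection \<open>P\<close> is injective on \<open>ker M\<close> by \<open>kernel_near_disjoint\<close>; comparing dimensions, it is
  onto \<open>ker N\<close>.
\<close>

lemma kernel_near_surjective:
  fixes M :: "'a \<Rightarrow>\<^sub>L 'a"
  assumes near: "norm G * norm (M - N) < 1"
    and dim: "dim (blinfun_ker M) = dim (blinfun_ker N)"
    and "N u = 0"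
  obtains u' where "M u' = 0" "P u' = u"
proof -
  have lin: "linear P" by (simp add: blinfun.bounded_linear_right bounded_linear.linear)
  have span: "span (blinfun_ker M) = blinfun_ker M"
    by (simp add: span_eq_iff subspace_blinfun_ker)
  have "inj_on P (blinfun_ker M)"
  proof (rule inj_onI)
    fix a b assume "a \<in> blinfun_ker M" "b \<in> blinfun_ker M" "P a = P b"
    then have "M (a - b) = 0" "P (a - b) = 0"
      by (auto simp: blinfun_ker_def blinfun.diff_right)
    then have "a - b = 0" by (rule kernel_near_disjoint[OF near])
    then show "a = b" by simp
  qed
  then have "dim (P ` blinfun_ker M) = dim (blinfun_ker N)"
    using dim_image_eq[OF lin, of "blinfun_ker M"] span dim by simp
  moreover have "P ` blinfun_ker M \<subseteq> blinfun_ker N"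
    by (auto simp: blinfun_ker_def N_P)
  ultimately have "P ` blinfun_ker M = blinfun_ker N"
    by (intro subspace_dim_equal) (auto simp: subspace_blinfun_ker linear_subspace_image[OF lin])
  then have "u \<in> P ` blinfun_ker M" using \<open>N u = 0\<close> by (simp add: blinfun_ker_def)
  then show thesis using that by (auto simp: blinfun_ker_def)
qed

text \<open>
  If a perturbation keeps the dimension of the kernel, its block on \<open>ker N\<close> is of second order. Lift
  \<open>u\<close> to \<open>u'\<close> in \<open>ker M\<close>; then \<open>\<langle>u', M w\<rangle> = 0\<close> by skewness, and \<open>u - u'\<close> and \<open>M w = (M - N) w\<close> are both
  of first order.
\<close>

lemma constant_rank_defect:
  fixes M :: "'a \<Rightarrow>\<^sub>L 'a"
  assumes M_skew: "\<And>u v. M u \<bullet> v = - (u \<bullet> M v)"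
    and near: "norm G * norm (M - N) \<le> 1/2"
    and dim: "dim (blinfun_ker M) = dim (blinfun_ker N)"
    and u: "N u = 0" and w: "N w = 0"
  shows "\<bar>u \<bullet> M w\<bar> \<le> 2 * norm G * norm u * norm w * (norm (M - N))\<^sup>2"
proof -
  obtain u' where u': "M u' = 0" "P u' = u"
    using kernel_near_surjective[of M u] near dim u by auto
  let ?d = "norm (M - N)"
  have close: "norm (u' - u) \<le> norm G * ?d * norm u'"
    using pseudoinverse_near[OF u'(1)] u'(2) by simp
  also have "\<dots> \<le> 1/2 * norm u'" using near by (intro mult_right_mono) auto
  finally have "norm u' \<le> 2 * norm u"
    using norm_triangle_ineq2[of u' u] by linarith
  then have "norm G * ?d * norm u' \<le> norm G * ?d * (2 * norm u)"
    by (intro mult_left_mono) auto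
  with close have close': "norm (u - u') \<le> norm G * ?d * (2 * norm u)"
    by (simp add: norm_minus_commute)
  have "u \<bullet> M w = (u - u') \<bullet> ((M - N) w)"
    using M_skew[of u' w] by (simp add: inner_diff_left u'(1) blinfun.diff_left w)
  then have "\<bar>u \<bullet> M w\<bar> \<le> norm (u - u') * norm ((M - N) w)"
    using Cauchy_Schwarz_ineq2 by metis
  also have "\<dots> \<le> (norm G * ?d * (2 * norm u)) * (?d * norm w)"
    by (intro mult_mono close' norm_blinfun) auto
  finally show ?thesis by (simp add: power2_eq_square mult_ac)
qed

end

text \<open>
  The map \<open>N + P\<close> is bijective, as it respects the decomposition into image and kernel of \<open>N\<close>, and
  \<open>G = (N + P)\<^sup>-\<^sup>1 - P\<close>.
\<close>

lemma skew_pseudoinverse_exists: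
  fixes N :: "'a::euclidean_space \<Rightarrow>\<^sub>L 'a"
  assumes N: "N \<in> skew_endos"
  obtains P G where "skew_pseudoinverse N P G"
proof -
  note skew = skew_endosD[OF N]
  obtain P :: "'a \<Rightarrow>\<^sub>L 'a" where P_in: "\<And>v. P v \<in> blinfun_ker N"
    and orth: "\<And>v w. w \<in> blinfun_ker N \<Longrightarrow> (v - P v) \<bullet> w = 0"
    using orthogonal_projection_blinfun[OF subspace_blinfun_ker[of N]] by blast
  have N_P: "N (P v) = 0" for v using P_in by (simp add: blinfun_ker_def)
  have inner: "v \<bullet> w = P v \<bullet> w" if "N w = 0" for v w
    using orth[of w v] that by (simp add: blinfun_ker_def inner_diff_left)
  have P_self: "P u \<bullet> v = u \<bullet> P v" for u v
    using inner[OF N_P, of u v] inner[OF N_P, of v u] by (simp add: inner_commute)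
  have P_fix: "P w = w" if "N w = 0" for w
  proof -
    have "(w - P w) \<bullet> (w - P w) = 0"
      using inner[of "w - P w" w] that N_P by (simp add: blinfun.diff_right inner_diff_left)
    then show ?thesis by simp
  qed
  have P_N: "P (N v) = 0" for v
    using P_self[of "N v" "P (N v)"] skew[of v "P (N v)"]
    by (simp add: N_P P_fix)
  have "v = 0" if "(N + P) v = 0" for v
  proof -
    have "P (N v + P v) = 0" using that by (simp add: blinfun.add_left blinfun.zero_right)
    then have "P v = 0" by (simp add: blinfun.add_right P_N P_fix N_P)
    then have "N v = 0" using that by (simp add: blinfun.add_left)
    then show ?thesis using P_fix[of v] \<open>P v = 0\<close> by simp
  qed
  then obtain M :: "'a \<Rightarrow>\<^sub>L 'a" where M: "\<And>v. (N + P) (M v) = v" "\<And>v. M ((N + P) v) = v"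
    using injective_blinfun_inverse[of "N + P"] by blast
  have PP: "P (P v) = P v" for v by (rule P_fix[OF N_P])
  have M_P: "M (P v) = P v" for v
    using M(2)[of "P v"] by (simp add: blinfun.add_left N_P PP)
  have P_M: "P (M v) = P v" for v
  proof -
    have "P ((N + P) (M v)) = P (M v)" by (simp add: blinfun.bilinear_simps P_N PP)
    then show ?thesis by (simp add: M(1))
  qed
  have "skew_pseudoinverse N P (M - P)"
  proof
    fix v
    show "(M - P) (N v) = v - P v"
      using M(2)[of v] by (simp add: blinfun.bilinear_simps P_N M_P eq_diff_eq)
    show "N ((M - P) v) = v - P v"
      using M(1)[of v] by (simp add: blinfun.bilinear_simps N_P P_M eq_diff_eq)
    show "P ((M - P) v) = 0" by (simp add: blinfun.bilinear_simps P_M PP)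
  qed (fact skew N_P P_fix P_self)+
  then show thesis by (rule that)
qed


section \<open>The splitting and compressions\<close>

text \<open>
  The three summands are pairwise orthogonal. The commutator is skew and vanishes on both kernels,
  so its image is orthogonal to them. For \<open>a\<close> in \<open>ker (J + K)\<close> and \<open>b\<close> in \<open>ker (J - K)\<close>, isometry of
  \<open>K\<close> and \<open>J\<close> gives \<open>\<langle>a, b\<rangle> = \<langle>K a, K b\<rangle> = - \<langle>J a, J b\<rangle> = - \<langle>a, b\<rangle>\<close>.
\<close>

lemma splitting_projections:
  assumes J: "J \<in> complex_structures" and K: "K \<in> complex_structures"
  shows "proj_plus J K v \<in> blinfun_ker (J + K)"
    and "w \<in> blinfun_ker (J + K) \<Longrightarrow> (v - proj_plus J K v) \<bullet> w = 0"
    and "proj_minus J K v \<in> blinfun_ker (J - K)"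
    and "w \<in> blinfun_ker (J - K) \<Longrightarrow> (v - proj_minus J K v) \<bullet> w = 0"
proof -
  note Jsk = complex_structure_skew[OF J] and Ksk = complex_structure_skew[OF K]
  obtain x y z where xyz: "splitting_components J K v = (x, y, z)" by (rule prod_cases3)
  have "case splitting_components J K v of (x, y, z) \<Rightarrow>
      x \<in> range (commutator J K) \<and> y \<in> blinfun_ker (J + K) \<and>
      z \<in> blinfun_ker (J - K) \<and> v = x + y + z"
    unfolding splitting_components_def by (rule theI'[OF splitting_unique_existence[OF J K]])
  then have x: "x \<in> range (commutator J K)" and y: "y \<in> blinfun_ker (J + K)"
    and z: "z \<in> blinfun_ker (J - K)" and v: "v = x + y + z"
    by (simp_all add: xyz)
  obtain u where u: "x = J (K u) - K (J u)"
    using x by (auto simp: commutator_def blinfun.bilinear_simps)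
  have x_orth: "x \<bullet> w = 0" if "K (J w) = J (K w)" for w
    by (simp add: u inner_diff_left Jsk Ksk that)
  have plus: "K w = - J w" if "w \<in> blinfun_ker (J + K)" for w
    using that by (simp add: blinfun_ker_def blinfun.add_left eq_neg_iff_add_eq_0 add.commute)
  have minus: "K w = J w" if "w \<in> blinfun_ker (J - K)" for w
    using that by (simp add: blinfun_ker_def blinfun.diff_left)
  have x_plus: "x \<bullet> w = 0" if "w \<in> blinfun_ker (J + K)" for w
  proof (rule x_orth)
    have J_w: "J w = - K w" using plus[OF that] by simp
    have "K (J w) = w"
      unfolding J_w by (simp add: blinfun.minus_right complex_structure_square[OF K])
    moreover have "J (K w) = w"
      using plus[OF that] by (simp add: blinfun.minus_right complex_structure_square[OF J])
    ultimately show "K (J w) = J (K w)" by simp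
  qed
  have x_minus: "x \<bullet> w = 0" if "w \<in> blinfun_ker (J - K)" for w
  proof (rule x_orth)
    have "K (J w) = - w"
      unfolding minus[OF that, symmetric] by (rule complex_structure_square[OF K])
    moreover have "J (K w) = - w"
      unfolding minus[OF that] by (rule complex_structure_square[OF J])
    ultimately show "K (J w) = J (K w)" by simp
  qed
  have plus_minus: "a \<bullet> b = 0" if "a \<in> blinfun_ker (J + K)" "b \<in> blinfun_ker (J - K)" for a b
  proof -
    have "a \<bullet> b = K a \<bullet> K b" using K by (simp add: complex_structures_def)
    also have "\<dots> = - (J a \<bullet> J b)" by (simp add: plus that minus)
    also have "\<dots> = - (a \<bullet> b)" using J by (simp add: complex_structures_def)
    finally show ?thesis by simp
  qed
  have proj: "proj_plus J K v = y" "proj_minus J K v = z"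
    by (simp_all add: proj_plus_def proj_minus_def xyz)
  show "proj_plus J K v \<in> blinfun_ker (J + K)" "proj_minus J K v \<in> blinfun_ker (J - K)"
    unfolding proj by (fact y z)+
  show "(v - proj_plus J K v) \<bullet> w = 0" if w: "w \<in> blinfun_ker (J + K)"
    unfolding proj using x_plus[OF w] plus_minus[OF w z]
    by (simp add: v inner_add_left inner_add_right inner_commute)
  show "(v - proj_minus J K v) \<bullet> w = 0" if w: "w \<in> blinfun_ker (J - K)"
    unfolding proj using x_minus[OF w] plus_minus[OF y w]
    by (simp add: v inner_add_left)
qed

text \<open>
  The condition \<open>P A P = 0\<close> for the orthogonal projection \<open>P\<close> onto \<open>W\<close>, stated without reference
  to a projection.
\<close>

definition compression_vanishes ::
  "('a::euclidean_space \<Rightarrow>\<^sub>L 'a) \<Rightarrow> 'a set \<Rightarrow> bool" where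
  "compression_vanishes A W \<longleftrightarrow> (\<forall>u\<in>W. \<forall>w\<in>W. A u \<bullet> w = 0)"

lemma projection_compression_iff:
  fixes A :: "'a::euclidean_space \<Rightarrow>\<^sub>L 'a"
  assumes W: "subspace W"
    and p: "\<And>v. p v \<in> W" "\<And>v w. w \<in> W \<Longrightarrow> (v - p v) \<bullet> w = 0"
  shows "p \<circ> A \<circ> p = (\<lambda>_. 0) \<longleftrightarrow> compression_vanishes A W"
proof
  have fixed: "p w = w" if "w \<in> W" for w
  proof -
    have "(w - p w) \<bullet> (w - p w) = 0"
      using p that W by (simp add: subspace_diff)
    then show ?thesis by simp
  qed
  assume "p \<circ> A \<circ> p = (\<lambda>_. 0)"
  then have zero: "p (A (p v)) = 0" for v by (simp add: fun_eq_iff)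
  show "compression_vanishes A W"
    unfolding compression_vanishes_def
  proof (intro ballI)
    fix u w assume "u \<in> W" "w \<in> W"
    then show "A u \<bullet> w = 0" using p(2)[of w "A u"] zero[of u] fixed[of u] by simp
  qed
next
  assume "compression_vanishes A W"
  then have "A (p v) \<bullet> p (A (p v)) = 0" for v
    using p(1) by (simp add: compression_vanishes_def)
  then have "p (A (p v)) \<bullet> p (A (p v)) = 0" for v
    using p(2)[OF p(1), of "A (p v)" "A (p v)"] by (simp add: inner_diff_left)
  then show "p \<circ> A \<circ> p = (\<lambda>_. 0)" by (simp add: fun_eq_iff)
qed

section \<open>Tangent spaces of the strata\<close>

lemma difference_quotient_tendsto:
  assumes "(f has_vector_derivative D) (at (0::real))"
  shows "((\<lambda>t. (f t - f 0) /\<^sub>R t) \<longlongrightarrow> D) (at 0)"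
proof -
  have lim: "((\<lambda>t. norm (f t - f 0 - t *\<^sub>R D) / norm t) \<longlongrightarrow> 0) (at 0)"
    using assms unfolding has_vector_derivative_def has_derivative_iff_norm by simp
  have quot: "norm (f t - f 0 - t *\<^sub>R D) / norm t = norm ((f t - f 0) /\<^sub>R t - D)" if "t \<noteq> 0" for t
  proof -
    have "(f t - f 0) /\<^sub>R t - D = (f t - f 0 - t *\<^sub>R D) /\<^sub>R t"
      using that by (simp add: scaleR_diff_right)
    then show ?thesis by (simp add: divide_inverse mult.commute)
  qed
  have "((\<lambda>t. norm ((f t - f 0) /\<^sub>R t - D)) \<longlongrightarrow> 0) (at 0)"
    by (rule Lim_transform_eventually[OF lim])
       (use quot in \<open>auto simp: eventually_at intro!: exI[of _ 1]\<close>)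
  then show ?thesis by (simp add: tendsto_norm_zero_iff LIM_zero_iff)
qed

lemma stratum_plus_complex_structure:
  "K \<in> stratum_plus J m \<Longrightarrow> K \<in> complex_structures"
  by (simp add: stratum_plus_def)

lemma sum_complex_structures_skew:
  assumes "J \<in> complex_structures" "K \<in> complex_structures"
  shows "J + K \<in> skew_endos"
  unfolding skew_endos_def
  by (simp add: blinfun.add_left inner_add_left inner_add_right
      complex_structure_skew[OF assms(1)] complex_structure_skew[OF assms(2)])

text \<open>
  The map \<open>N = J + K\<close> intertwines \<open>J\<close> and \<open>K\<close>, that is \<open>N J = K N\<close> and \<open>N K = J N\<close>. Its
  pseudo-inverse inherits this, and its kernel is invariant under both.
\<close>

locale complex_structure_pair = skew_pseudoinverse N P G
  for N P G :: "'a::euclidean_space \<Rightarrow>\<^sub>L 'a" +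
  fixes J K :: "'a \<Rightarrow>\<^sub>L 'a"
  assumes J: "J \<in> complex_structures" and K: "K \<in> complex_structures"
    and N_def: "N = J + K"
begin

lemmas JJ = complex_structure_square[OF J] and KK = complex_structure_square[OF K]

lemma N: "N v = J v + K v"
  by (simp add: N_def blinfun.add_left)

lemma N_J: "N (J v) = K (N v)" and N_K: "N (K v) = J (N v)"
  by (simp_all add: N JJ KK blinfun.add_right add.commute)

lemma J_P: "J (P v) = - K (P v)"
  using N_P[of v] by (simp add: N eq_neg_iff_add_eq_0)

lemma P_K: "P (K v) = K (P v)"
proof -
  have "P (K (v - P v)) = P (N (J (G v)))" by (simp add: N_J N_G)
  then have "P (K v) = P (K (P v))" by (simp add: P_N blinfun.diff_right)
  also have "\<dots> = K (P v)" by (rule P_fix) (simp add: N_K N_P blinfun.zero_right)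
  finally show ?thesis .
qed

lemma P_J: "P (J v) = - K (P v)"
proof -
  have "P (N v) = P (J v) + P (K v)" by (simp add: N blinfun.add_right)
  then show ?thesis by (simp add: P_N P_K eq_neg_iff_add_eq_0)
qed

lemma G_K: "G (K v) = J (G v)"
proof -
  have "G (K (v - P v)) = G (N (J (G v)))" by (simp add: N_J N_G)
  also have "\<dots> = J (G v)" by (simp add: G_N P_J P_G blinfun.bilinear_simps)
  finally show ?thesis by (simp add: blinfun.diff_right P_K[symmetric] G_P)
qed

lemma G_J: "G (J v) = K (G v)"
proof -
  have "G (J (v - P v)) = G (N (K (G v)))" by (simp add: N_K N_G)
  also have "\<dots> = K (G v)" by (simp add: G_N P_K P_G blinfun.bilinear_simps)
  finally show ?thesis
    by (simp add: blinfun.diff_right blinfun.add_right blinfun.minus_right J_P P_K[symmetric] G_P)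
qed

lemma P_ker_diff:
  assumes "u \<in> blinfun_ker (J - K)"
  shows "P u = 0"
proof -
  have "J u = K u" using assms by (simp add: blinfun_ker_def blinfun.diff_left)
  then have "K (P u) = - K (P u)" using P_J[of u] P_K[of u] by simp
  then have "K (P u) = 0" by (simp add: eq_neg_iff_add_eq_0 flip: scaleR_2)
  then show ?thesis using KK[of "P u"] by (simp add: blinfun.zero_right)
qed

end

lemma complex_structure_pair_exists:
  assumes "J \<in> complex_structures" "K \<in> complex_structures"
  obtains P G where "complex_structure_pair (J + K) P G J K"
proof -
  obtain P G where "skew_pseudoinverse (J + K) P G"
    using skew_pseudoinverse_exists[OF sum_complex_structures_skew[OF assms]] .
  then show thesis
    using assms that by (simp add: complex_structure_pair_def complex_structure_pair_axioms_def)
qed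

text \<open>
  By \<open>constant_rank_defect\<close> the function \<open>\<langle>w, (\<gamma> t - K) v\<rangle>\<close> is bounded by a multiple of
  \<open>\<parallel>\<gamma> t - K\<parallel>\<^sup>2\<close>. After division by \<open>t\<close> the bound tends to \<open>0 \<cdot> \<parallel>A\<parallel>\<close>, which forces \<open>\<langle>w, A v\<rangle> = 0\<close>.
\<close>

lemma tangent_space_stratum_plus_subset:
  assumes J: "J \<in> complex_structures" and K: "K \<in> stratum_plus J m"
    and A: "A \<in> tangent_space (stratum_plus J m) K"
  shows "compression_vanishes A (blinfun_ker (J + K))"
  unfolding compression_vanishes_def
proof (intro ballI)
  fix v w assume vw: "v \<in> blinfun_ker (J + K)" "w \<in> blinfun_ker (J + K)"
  have Kc: "K \<in> complex_structures" using K by (rule stratum_plus_complex_structure)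
  obtain P G where "skew_pseudoinverse (J + K) P G"
    using skew_pseudoinverse_exists[OF sum_complex_structures_skew[OF J Kc]] .
  then interpret skew_pseudoinverse "J + K" P G .
  obtain \<epsilon> \<gamma> where \<epsilon>: "\<epsilon> > 0" and \<gamma>: "\<And>t. \<bar>t\<bar> < \<epsilon> \<Longrightarrow> \<gamma> t \<in> stratum_plus J m"
    and \<gamma>0: "\<gamma> 0 = K" and deriv: "(\<gamma> has_vector_derivative A) (at 0)"
    using A by (rule tangent_spaceE) blast
  let ?q = "\<lambda>t. (\<gamma> t - K) /\<^sub>R t"
  have q: "(?q \<longlongrightarrow> A) (at 0)"
    using difference_quotient_tendsto[OF deriv] by (simp add: \<gamma>0)
  have "(\<gamma> \<longlongrightarrow> K) (at 0)"
    using has_vector_derivative_continuous[OF deriv] by (simp add: continuous_at \<gamma>0)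
  then have dist: "((\<lambda>t. norm (\<gamma> t - K)) \<longlongrightarrow> 0) (at 0)"
    by (simp add: tendsto_norm_zero_iff LIM_zero_iff)
  then have "((\<lambda>t. norm G * norm (\<gamma> t - K)) \<longlongrightarrow> norm G * 0) (at 0)"
    by (intro tendsto_intros)
  then have near: "eventually (\<lambda>t. norm G * norm (\<gamma> t - K) < 1/2) (at 0)"
    by (rule order_tendstoD) simp
  have small: "eventually (\<lambda>t. \<bar>t\<bar> < \<epsilon>) (at 0)"
    using \<epsilon> by (auto simp: eventually_at dist_real_def intro!: exI[of _ \<epsilon>])
  let ?C = "2 * norm G * norm w * norm v"
  have bound: "eventually (\<lambda>t. \<bar>w \<bullet> ?q t v\<bar> \<le> ?C * (norm (\<gamma> t - K) * norm (?q t))) (at 0)"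
    using near small
  proof eventually_elim
    case (elim t)
    have mem: "\<gamma> t \<in> stratum_plus J m" using elim \<gamma> by auto
    have sk: "(J + \<gamma> t) a \<bullet> b = - (a \<bullet> (J + \<gamma> t) b)" for a b
      using sum_complex_structures_skew[OF J stratum_plus_complex_structure[OF mem]]
      by (rule skew_endosD)
    have "\<bar>w \<bullet> (J + \<gamma> t) v\<bar> \<le> ?C * (norm ((J + \<gamma> t) - (J + K)))\<^sup>2"
      by (rule constant_rank_defect[OF sk])
         (use elim mem K vw in \<open>auto simp: stratum_plus_def blinfun_ker_def\<close>)
    moreover have "(J + \<gamma> t) v = (\<gamma> t - K) v"
      using vw(1) by (simp add: blinfun_ker_def blinfun.add_left blinfun.diff_left eq_neg_iff_add_eq_0[symmetric])
    ultimately have main: "\<bar>w \<bullet> (\<gamma> t - K) v\<bar> \<le> ?C * (norm (\<gamma> t - K))\<^sup>2" by simp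
    have "\<bar>w \<bullet> ?q t v\<bar> = \<bar>w \<bullet> (\<gamma> t - K) v\<bar> / \<bar>t\<bar>"
      by (simp add: blinfun.scaleR_left abs_mult divide_inverse mult.commute)
    also have "\<dots> \<le> ?C * (norm (\<gamma> t - K))\<^sup>2 / \<bar>t\<bar>"
      by (rule divide_right_mono[OF main]) simp
    also have "\<dots> = ?C * (norm (\<gamma> t - K) * norm (?q t))"
      by (simp add: power2_eq_square divide_inverse)
    finally show ?case .
  qed
  have qv: "((\<lambda>t. ?q t v) \<longlongrightarrow> A v) (at 0)"
    by (rule blinfun.tendsto[OF q tendsto_const])
  have "((\<lambda>t. \<bar>w \<bullet> ?q t v\<bar>) \<longlongrightarrow> \<bar>w \<bullet> A v\<bar>) (at 0)"
    by (intro tendsto_rabs tendsto_inner tendsto_const qv)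
  moreover have "((\<lambda>t. ?C * (norm (\<gamma> t - K) * norm (?q t))) \<longlongrightarrow> ?C * (0 * norm A)) (at 0)"
    by (intro tendsto_intros dist q)
  ultimately have "\<bar>w \<bullet> A v\<bar> \<le> ?C * (0 * norm A)"
    using bound by (intro tendsto_le[of "at (0::real)"]) auto
  then show "A v \<bullet> w = 0" by (simp add: inner_commute)
qed

text \<open>
  The inner conjugation realizes the block \<open>E\<close> of \<open>A\<close> on the complement of \<open>ker (J + K)\<close> without
  changing that kernel. The outer one realizes the off-diagonal part and transports the kernel.
\<close>

lemma tangent_space_stratum_plus_superset:
  assumes J: "J \<in> complex_structures" and KS: "K \<in> stratum_plus J m"
    and A: "A \<in> skew_anticommuting K" and compr: "compression_vanishes A (blinfun_ker (J + K))"
  shows "A \<in> tangent_space (stratum_plus J m) K"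
proof -
  have K: "K \<in> complex_structures" using KS by (rule stratum_plus_complex_structure)
  note JJ = complex_structure_square[OF J] and KK = complex_structure_square[OF K]
  define N where "N = J + K"
  obtain P G where "complex_structure_pair N P G J K"
    using complex_structure_pair_exists[OF J K] unfolding N_def .
  then interpret complex_structure_pair N P G J K .
  have A_K: "A (K v) = - K (A v)" for v using A by (simp add: skew_anticommuting_iff)
  have A_skew: "A u \<bullet> v = - (u \<bullet> A v)" for u v
    using A by (simp add: skew_anticommuting_iff skew_endosD)
  have PAP: "P (A (P v)) = 0" for v
  proof -
    have "A (P v) \<bullet> P (A (P v)) = 0"
      using compr N_P by (simp add: compression_vanishes_def blinfun_ker_def flip: N_def)
    then have "P (A (P v)) \<bullet> P (A (P v)) = 0"
      by (simp add: P_selfadjoint P_idem)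
    then show ?thesis by simp
  qed
  \<comment> \<open>Writing \<open>X\<close> as \<open>S - S\<^sup>T\<close> with \<open>S\<close> from \<open>ker N\<close> to its complement and commuting with \<open>J\<close>, one finds
    \<open>[X, K] = - N S\<close> on \<open>ker N\<close>. So \<open>S = - G A P\<close> gives the off-diagonal part of \<open>A\<close>.\<close>
  define X where "X = (P o\<^sub>L (A o\<^sub>L G)) - (G o\<^sub>L (A o\<^sub>L P))"
  have X: "X v = P (A (G v)) - G (A (P v))" for v by (simp add: X_def blinfun.diff_left)
  \<comment> \<open>As \<open>P A P = 0\<close>, this is \<open>(1 - P) A (1 - P)\<close>.\<close>
  define E where "E = A - (P o\<^sub>L A) - (A o\<^sub>L P)"
  have E: "E v = A v - P (A v) - A (P v)" for v by (simp add: E_def blinfun.diff_left)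
  have X_skew: "X \<in> skew_endos"
    unfolding skew_endos_def
    by (simp add: X inner_diff_left inner_diff_right P_selfadjoint G_skew A_skew)
  have X_J: "X (J v) = J (X v)" for v
    by (simp add: X G_J P_J A_K P_K G_K J_P blinfun.minus_right blinfun.diff_right)
  have X_K: "commutator X K + E = A"
  proof (rule blinfun_eqI)
    fix v
    have J_G: "J (G u) = u - P u - K (G u)" for u
      using N_G[of u] by (simp add: N eq_diff_eq)
    show "(commutator X K + E) v = A v"
      by (simp add: commutator_def blinfun.bilinear_simps X E G_K P_K A_K J_G PAP)
  qed
  have E_anti: "E \<in> skew_anticommuting K"
    unfolding skew_anticommuting_iff skew_endos_def
    by (simp add: E inner_diff_left inner_diff_right P_selfadjoint A_skew A_K P_K blinfun.bilinear_simps)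
  have E_ker: "E w = 0" if "N w = 0" for w
    using PAP[of w] by (simp add: E P_fix[OF that])
  define Y where "Y = (-1/2) *\<^sub>R (E o\<^sub>L K)"
  have Y: "Y \<in> skew_endos" "commutator Y K = E"
    using commutator_half_twist[OF K E_anti] by (simp_all add: Y_def)
  have K_ker: "N (K w) = 0" if "N w = 0" for w by (simp add: N_K that blinfun.zero_right)
  have Y_ker: "Y w = 0" if "N w = 0" for w
    using E_ker[OF K_ker[OF that]] by (simp add: Y_def blinfun.bilinear_simps)
  define \<gamma> where "\<gamma> = conjugation_curve Y (\<lambda>_. K)"
  have \<gamma>_alg: "\<gamma> \<in> resolvent_algebra"
    unfolding \<gamma>_def by (intro conjugation_curve_in_resolvent_algebra Y resolvent_algebra.const)
  have \<gamma>0: "\<gamma> 0 = K" by (simp add: \<gamma>_def conjugation_curve_zero Y)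
  have \<gamma>_cs: "\<gamma> t \<in> complex_structures" for t
    unfolding \<gamma>_def by (intro conjugation_curve_complex_structure Y K)
  have \<gamma>_deriv: "(\<gamma> has_vector_derivative E) (at 0)"
    using has_vector_derivative_conjugation_curve[OF Y(1) has_vector_derivative_const[of K]]
    unfolding \<gamma>_def Y(2) by simp
  have "(\<gamma> \<longlongrightarrow> K) (at 0)"
    using has_vector_derivative_continuous[OF \<gamma>_deriv] by (simp add: continuous_at \<gamma>0)
  then have "((\<lambda>t. norm G * norm (\<gamma> t - K)) \<longlongrightarrow> norm G * norm (K - K)) (at 0)"
    by (intro tendsto_intros)
  then have "eventually (\<lambda>t. norm G * norm (\<gamma> t - K) < 1) (at 0)"
    by (rule order_tendstoD) simp
  then obtain \<epsilon> where \<epsilon>: "\<epsilon> > 0"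
    and "\<And>t. t \<noteq> 0 \<Longrightarrow> \<bar>t\<bar> < \<epsilon> \<Longrightarrow> norm G * norm (\<gamma> t - K) < 1"
    unfolding eventually_at by (auto simp: dist_real_def)
  then have near: "norm G * norm (\<gamma> t - K) < 1" if "\<bar>t\<bar> < \<epsilon>" for t
    using that \<gamma>0 by (cases "t = 0") auto
  have ker_\<gamma>: "blinfun_ker (J + \<gamma> t) = blinfun_ker N" if "\<bar>t\<bar> < \<epsilon>" for t
  proof (rule kernel_near_eq)
    show "norm G * norm (J + \<gamma> t - N) < 1" using near[OF that] by (simp add: N_def)
    fix w assume w: "N w = 0"
    have "cayley (- Y) t w = w"
      by (rule cayley_fix) (simp_all add: skew_endos_minus Y blinfun.minus_left Y_ker w)
    moreover have "cayley Y t (K w) = K w"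
      by (rule cayley_fix) (simp_all add: Y Y_ker K_ker w)
    ultimately show "(J + \<gamma> t) w = 0"
      using w by (simp add: blinfun.add_left \<gamma>_def conjugation_curve_apply N)
  qed
  let ?\<kappa> = "conjugation_curve X \<gamma>"
  have ker_\<kappa>: "blinfun_ker (J + ?\<kappa> t) = cayley X t ` blinfun_ker (J + \<gamma> t)" for t
  proof -
    have conj: "(J + ?\<kappa> t) (cayley X t v) = cayley X t ((J + \<gamma> t) v)" for v
      by (simp add: blinfun.add_left blinfun.add_right conjugation_curve_apply
          cayley_minus_cancel[OF X_skew] cayley_commute[OF X_skew X_J])
    have inj: "cayley X t v = 0 \<longleftrightarrow> v = 0" for v
      using cayley_minus_cancel[OF X_skew, of t v] by (auto simp: blinfun.zero_right)
    show ?thesis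
    proof (intro equalityI subsetI)
      fix v assume v: "v \<in> blinfun_ker (J + ?\<kappa> t)"
      let ?u = "cayley (- X) t v"
      have u: "v = cayley X t ?u" by (simp add: cayley_cancel[OF X_skew])
      have "(J + ?\<kappa> t) (cayley X t ?u) = 0"
        unfolding u[symmetric] using v by (simp add: blinfun_ker_def)
      then have "?u \<in> blinfun_ker (J + \<gamma> t)" unfolding conj inj blinfun_ker_def by simp
      then show "v \<in> cayley X t ` blinfun_ker (J + \<gamma> t)" using u by (rule rev_image_eqI)
    qed (auto simp: blinfun_ker_def conj blinfun.zero_right)
  qed
  have "?\<kappa> t \<in> stratum_plus J m" if "\<bar>t\<bar> < \<epsilon>" for t
  proof -
    have "inj (cayley X t)"
      by (rule inj_on_inverseI[of _ "cayley (- X) t"]) (rule cayley_minus_cancel[OF X_skew])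
    then have "dim (cayley X t ` blinfun_ker N) = dim (blinfun_ker N)"
      by (intro dim_image_eq)
         (auto simp: blinfun.bounded_linear_right bounded_linear.linear intro: inj_on_subset)
    moreover have "dim (blinfun_ker N) = 2 * m" using KS by (simp add: stratum_plus_def N_def)
    ultimately show ?thesis
      unfolding stratum_plus_def
      by (simp add: ker_\<kappa> ker_\<gamma>[OF that] conjugation_curve_complex_structure[where \<gamma> = \<gamma>] X_skew \<gamma>_cs)
  qed
  then show ?thesis
    using \<epsilon> conjugation_curve_in_resolvent_algebra[OF X_skew \<gamma>_alg]
      conjugation_curve_zero[OF X_skew, of \<gamma>]
      has_vector_derivative_conjugation_curve[OF X_skew \<gamma>_deriv]
    by (intro tangent_spaceI[of ?\<kappa> \<epsilon>]) (simp_all add: \<gamma>0 X_K)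
qed

lemma tangent_space_stratum_plus:
  assumes J: "J \<in> complex_structures" and K: "K \<in> stratum_plus J m"
  shows "tangent_space (stratum_plus J m) K =
    {A \<in> skew_anticommuting K. compression_vanishes A (blinfun_ker (J + K))}"
proof -
  have "stratum_plus J m \<subseteq> complex_structures" by (auto simp: stratum_plus_def)
  from tangent_space_complex_structures_subset[OF this] show ?thesis
    using tangent_space_stratum_plus_subset[OF J K] tangent_space_stratum_plus_superset[OF J K]
    by blast
qed

lemma blinfun_ker_minus_flip: "blinfun_ker (J - K) = blinfun_ker (- J + K)"
  by (auto simp: blinfun_ker_def blinfun.bilinear_simps)

lemma stratum_minus_eq: "stratum_minus J m = stratum_plus (- J) m"
  unfolding stratum_minus_def stratum_plus_def by (simp only: blinfun_ker_minus_flip)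

lemma complex_structures_minus:
  assumes "J \<in> complex_structures"
  shows "- J \<in> complex_structures"
proof (rule complex_structuresI)
  show "(- J) ((- J) v) = - v" for v
    by (simp add: blinfun.minus_left blinfun.minus_right complex_structure_square[OF assms])
  show "(- J) u \<bullet> (- J) v = u \<bullet> v" for u v
    using assms by (simp add: blinfun.minus_left complex_structures_def)
qed

lemma tangent_space_stratum_minus:
  assumes J: "J \<in> complex_structures" and K: "K \<in> stratum_minus J m"
  shows "tangent_space (stratum_minus J m) K =
    {A \<in> skew_anticommuting K. compression_vanishes A (blinfun_ker (J - K))}"
  using tangent_space_stratum_plus[OF complex_structures_minus[OF J], of K m] K
  by (simp only: stratum_minus_eq blinfun_ker_minus_flip)

section \<open>Transversality\<close>

text \<open>
  \<open>P A P\<close> with \<open>P\<close> the orthogonal projection onto \<open>ker (J + K)\<close> serves as the second summand: it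
  carries the whole block of \<open>A\<close> on \<open>ker (J + K)\<close> and vanishes on the orthogonal \<open>ker (J - K)\<close>.
\<close>

lemma skew_anticommuting_splitting:
  assumes J: "J \<in> complex_structures" and K: "K \<in> complex_structures"
    and A: "A \<in> skew_anticommuting K"
  obtains A1 A2 where "A = A1 + A2" "A1 \<in> skew_anticommuting K" "A2 \<in> skew_anticommuting K"
    "compression_vanishes A1 (blinfun_ker (J + K))"
    "compression_vanishes A2 (blinfun_ker (J - K))"
proof -
  define N where "N = J + K"
  obtain P G where "complex_structure_pair N P G J K"
    using complex_structure_pair_exists[OF J K] unfolding N_def .
  then interpret complex_structure_pair N P G J K .
  have A_K: "A (K v) = - K (A v)" for v using A by (simp add: skew_anticommuting_iff)
  have A_skew: "A u \<bullet> v = - (u \<bullet> A v)" for u v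
    using A by (simp add: skew_anticommuting_iff skew_endosD)
  define B where "B = P o\<^sub>L (A o\<^sub>L P)"
  have B: "B v = P (A (P v))" for v by (simp add: B_def)
  show thesis
  proof
    show "A = (A - B) + B" by simp
    show "B \<in> skew_anticommuting K" "A - B \<in> skew_anticommuting K"
      unfolding skew_anticommuting_iff skew_endos_def
      by (simp_all add: B inner_diff_left inner_diff_right P_selfadjoint A_skew A_K P_K
          blinfun.bilinear_simps)
    show "compression_vanishes (A - B) (blinfun_ker (J + K))"
      by (simp add: compression_vanishes_def blinfun_ker_def flip: N_def, simp add: B P_fix P_selfadjoint
          blinfun.diff_left inner_diff_left)
    show "compression_vanishes B (blinfun_ker (J - K))"
      by (simp add: compression_vanishes_def B P_selfadjoint P_ker_diff blinfun.zero_right)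
  qed
qed

lemma strata_transversal:
  assumes J: "J \<in> complex_structures"
  shows "transversal_in complex_structures (stratum_plus J mp) (stratum_minus J mm)"
  unfolding transversal_in_def
proof
  fix K assume "K \<in> stratum_plus J mp \<inter> stratum_minus J mm"
  then have plus: "K \<in> stratum_plus J mp" and minus: "K \<in> stratum_minus J mm" by auto
  have K: "K \<in> complex_structures" using plus by (rule stratum_plus_complex_structure)
  have add: "A1 + A2 \<in> skew_anticommuting K"
    if "A1 \<in> skew_anticommuting K" "A2 \<in> skew_anticommuting K" for A1 A2
    using that
    by (simp add: skew_anticommuting_iff skew_endos_def blinfun.bilinear_simps inner_add_left inner_add_right)
  show "{u + v |u v. u \<in> tangent_space (stratum_plus J mp) K \<and>
      v \<in> tangent_space (stratum_minus J mm) K} = tangent_space complex_structures K"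
    unfolding tangent_space_stratum_plus[OF J plus] tangent_space_stratum_minus[OF J minus]
      tangent_space_complex_structures[OF K]
    by (auto intro: add) (metis skew_anticommuting_splitting[OF J K])
qed

theorem proposition6p24:
  fixes J :: "'a::euclidean_space \<Rightarrow>\<^sub>L 'a" and n mp mm :: nat
  assumes "DIM('a) = 2 * n"
    and "J \<in> complex_structures"
  shows "(\<forall>K \<in> stratum_plus J mp.
            tangent_space (stratum_plus J mp) K =
              {A \<in> skew_anticommuting K. proj_plus J K \<circ> A \<circ> proj_plus J K = (\<lambda>_. 0)}) \<and>
         (\<forall>K \<in> stratum_minus J mm.
            tangent_space (stratum_minus J mm) K =
              {A \<in> skew_anticommuting K. proj_minus J K \<circ> A \<circ> proj_minus J K = (\<lambda>_. 0)}) \<and>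
         ((\<exists>k::nat. int n - int mp - int mm = 2 * int k) \<longrightarrow>
            transversal_in complex_structures (stratum_plus J mp) (stratum_minus J mm))"
proof (intro conjI ballI impI)
  note J = assms(2)
  show "tangent_space (stratum_plus J mp) K =
      {A \<in> skew_anticommuting K. proj_plus J K \<circ> A \<circ> proj_plus J K = (\<lambda>_. 0)}"
    if K: "K \<in> stratum_plus J mp" for K
  proof -
    have "K \<in> complex_structures" using K by (simp add: stratum_plus_def)
    note split = splitting_projections[OF J this]
    show ?thesis
      unfolding tangent_space_stratum_plus[OF J K]
      by (simp only: projection_compression_iff[OF subspace_blinfun_ker split(1,2)])
  qed
  show "tangent_space (stratum_minus J mm) K =
      {A \<in> skew_anticommuting K. proj_minus J K \<circ> A \<circ> proj_minus J K = (\<lambda>_. 0)}"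
    if K: "K \<in> stratum_minus J mm" for K
  proof -
    have "K \<in> complex_structures" using K by (simp add: stratum_minus_def)
    note split = splitting_projections[OF J this]
    show ?thesis
      unfolding tangent_space_stratum_minus[OF J K]
      by (simp only: projection_compression_iff[OF subspace_blinfun_ker split(3,4)])
  qed
  show "transversal_in complex_structures (stratum_plus J mp) (stratum_minus J mm)"
    by (rule strata_transversal[OF J])
qed

end
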